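(* Let $(M,\omega)$ be a Hermitian manifold of complex dimension $n\ge 3$ and let $k$ be an integer with $1\le k\le n-1$. If $(M,\omega)$ is $k$-Gauduchon, then $s\ge\hat s$ on $M$. In particular, if $(M,\omega)$ is pluriclosed or Astheno-Kähler, then $s\ge\hat s$.
   Context: Locally $\omega=\sqrt{-1}\,h_{i\bar j}dz^i\wedge d\bar z^j$. The Chern connection has Christoffel symbols $\Gamma_{ij}^k=h^{k\bar l}\partial_i h_{j\bar l}$ and curvature $R_{i\bar jk\bar l}=-h_{p\bar l}\,\partial_{\bar j}\Gamma^p_{ik}$. The scalar curvatures (both real) are $s=h^{i\bar j}h^{k\bar l}R_{i\bar jk\bar l}$ and $\hat s=h^{i\bar l}h^{k\bar j}R_{i\bar jk\bar l}$. $\omega$ is $k$-Gauduchon if $\partial\bar\partial\omega^k\wedge\omega^{n-k-1}=0$; pluriclosed if $\partial\bar\partial\omega=0$; Astheno-Kähler if $\partial\bar\partial\omega^{n-2}=0$. *)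

theory Defs
  imports "HOL-Analysis.Analysis" "HOL-Library.Complex_Order"
begin

section \<open>Calculus on open subsets of complex \<open>n\<close>-space\<close>

type_synonym 'n cvec = "(complex, 'n) vec"
type_synonym 'n cmat = "((complex, 'n) vec, 'n) vec"

fun Ck_on :: "nat \<Rightarrow> 'a::real_normed_vector set \<Rightarrow> ('a \<Rightarrow> 'b::real_normed_vector) \<Rightarrow> bool" where
  "Ck_on 0 S f \<longleftrightarrow> continuous_on S f"
| "Ck_on (Suc k) S f \<longleftrightarrow>
     (\<forall>x\<in>S. f differentiable (at x)) \<and> (\<forall>v. Ck_on k S (\<lambda>x. frechet_derivative f (at x) v))"

text \<open>Real \<open>C\<^sup>\<infinity>\<close> smoothness; only meant for open \<open>S\<close>.\<close>
definition smooth_on :: "'a::real_normed_vector set \<Rightarrow> ('a \<Rightarrow> 'b::real_normed_vector) \<Rightarrow> bool" where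
  "smooth_on S f \<longleftrightarrow> (\<forall>k. Ck_on k S f)"

text \<open>Holomorphic maps: real Frechet derivative that is complex linear at every point.\<close>
definition holomorphic_map_on :: "('n::finite cvec \<Rightarrow> 'm::finite cvec) \<Rightarrow> 'n cvec set \<Rightarrow> bool" where
  "holomorphic_map_on f S \<longleftrightarrow>
     (\<forall>x\<in>S. \<exists>D. (f has_derivative D) (at x) \<and> (\<forall>c v. D (c *s v) = c *s D v))"

text \<open>The Wirtinger derivatives with respect to \<open>z\<^sup>i\<close> and to its conjugate, where
  \<open>z\<^sup>i = x\<^sup>i + \<i> y\<^sup>i\<close>; the vectors \<open>axis i 1\<close> and \<open>axis i \<i>\<close> are \<open>\<partial>/\<partial>x\<^sup>i\<close> and \<open>\<partial>/\<partial>y\<^sup>i\<close>.\<close>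
definition pd :: "'n::finite \<Rightarrow> ('n cvec \<Rightarrow> complex) \<Rightarrow> 'n cvec \<Rightarrow> complex" where
  "pd i f x = (frechet_derivative f (at x) (axis i 1)
                 - \<i> * frechet_derivative f (at x) (axis i \<i>)) / 2"

definition pdbar :: "'n::finite \<Rightarrow> ('n cvec \<Rightarrow> complex) \<Rightarrow> 'n cvec \<Rightarrow> complex" where
  "pdbar i f x = (frechet_derivative f (at x) (axis i 1)
                    + \<i> * frechet_derivative f (at x) (axis i \<i>)) / 2"


section \<open>Hermitian manifolds\<close>

text \<open>A chart is a pair of its domain and its coordinate map; the values of the map outside the
  domain are irrelevant.\<close>
type_synonym ('a, 'n) chart = "'a set \<times> ('a \<Rightarrow> 'n cvec)"

definition transition :: "('a, 'n::finite) chart \<Rightarrow> ('a, 'n) chart \<Rightarrow> 'n cvec \<Rightarrow> 'n cvec" where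
  "transition c d = snd d \<circ> inv_into (fst c) (snd c)"

locale complex_manifold =
  fixes X :: "'a topology" and A :: "('a, 'n::finite) chart set"
  assumes hausdorff: "Hausdorff_space X"
    and second_countable: "second_countable X"
    and atlas_cover: "(\<Union>c\<in>A. fst c) = topspace X"
    and chart_domain: "c \<in> A \<Longrightarrow> openin X (fst c)"
    and chart_image: "c \<in> A \<Longrightarrow> open (snd c ` fst c)"
    and chart_homeo: "c \<in> A \<Longrightarrow>
      homeomorphic_map (subtopology X (fst c)) (top_of_set (snd c ` fst c)) (snd c)"
    and chart_compatible: "c \<in> A \<Longrightarrow> d \<in> A \<Longrightarrow>
      holomorphic_map_on (transition c d) (snd c ` (fst c \<inter> fst d))"

text \<open>A Hermitian metric is given by its coefficient matrices \<open>h c z $ i $ j\<close>, with \<open>i\<close> the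
  unbarred and \<open>j\<close> the barred index, at the point with coordinates \<open>z\<close> in the chart \<open>c\<close>. The last
  axiom is the transformation law that makes the fundamental form independent of the chart.\<close>
locale hermitian_manifold = complex_manifold X A
  for X :: "'a topology" and A :: "('a, 'n::finite) chart set" +
  fixes h :: "('a, 'n) chart \<Rightarrow> 'n cvec \<Rightarrow> 'n cmat"
  assumes metric_smooth: "c \<in> A \<Longrightarrow> smooth_on (snd c ` fst c) (\<lambda>z. h c z $ i $ j)"
    and metric_hermitian: "c \<in> A \<Longrightarrow> p \<in> fst c \<Longrightarrow>
      h c (snd c p) $ j $ i = cnj (h c (snd c p) $ i $ j)"
    and metric_pos: "c \<in> A \<Longrightarrow> p \<in> fst c \<Longrightarrow> v \<noteq> 0 \<Longrightarrow>
      0 < Re (\<Sum>i\<in>UNIV. \<Sum>j\<in>UNIV. h c (snd c p) $ i $ j * v $ i * cnj (v $ j))"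
    and metric_transform: "c \<in> A \<Longrightarrow> d \<in> A \<Longrightarrow> p \<in> fst c \<inter> fst d \<Longrightarrow>
      h c (snd c p) $ i $ j =
        (\<Sum>k\<in>UNIV. \<Sum>l\<in>UNIV. h d (snd d p) $ k $ l
           * pd i (\<lambda>z. transition c d z $ k) (snd c p)
           * cnj (pd j (\<lambda>z. transition c d z $ l) (snd c p)))"


section \<open>Chern connection and scalar curvatures in a coordinate chart\<close>

text \<open>The inverse metric with upper indices \<open>k\<close> (unbarred) and \<open>l\<close> (barred). It is normalised by
  \<open>(\<Sum>l\<in>UNIV. hinv H k l * H $ j $ l) = (if j = k then 1 else 0)\<close>, hence the swapped indices on the
  right.\<close>
definition hinv :: "'n::finite cmat \<Rightarrow> 'n \<Rightarrow> 'n \<Rightarrow> complex" where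
  "hinv H k l = matrix_inv H $ l $ k"

text \<open>In \<open>christoffel g i j k\<close> the index \<open>k\<close> is the upper one; in \<open>chern_curv g i j k l\<close> the
  indices \<open>j\<close> and \<open>l\<close> are barred.\<close>
definition christoffel ::
    "('n::finite cvec \<Rightarrow> 'n cmat) \<Rightarrow> 'n \<Rightarrow> 'n \<Rightarrow> 'n \<Rightarrow> 'n cvec \<Rightarrow> complex" where
  "christoffel g i j k z = (\<Sum>l\<in>UNIV. hinv (g z) k l * pd i (\<lambda>y. g y $ j $ l) z)"

definition chern_curv ::
    "('n::finite cvec \<Rightarrow> 'n cmat) \<Rightarrow> 'n \<Rightarrow> 'n \<Rightarrow> 'n \<Rightarrow> 'n \<Rightarrow> 'n cvec \<Rightarrow> complex" where
  "chern_curv g i j k l z = - (\<Sum>p\<in>UNIV. g z $ p $ l * pdbar j (christoffel g i k p) z)"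

text \<open>The two scalar curvatures \<open>s\<close> and \<open>s\<close>-hat. They take real values, but are kept in type
  \<^typ>\<open>complex\<close> as given by their defining formulas; they are compared with the order of
  \<^theory>\<open>HOL-Library.Complex_Order\<close>, for which \<open>a \<le> b\<close> means that \<open>b - a\<close> is real and nonnegative.\<close>
definition scalar_curv :: "('n::finite cvec \<Rightarrow> 'n cmat) \<Rightarrow> 'n cvec \<Rightarrow> complex" where
  "scalar_curv g z = (\<Sum>i\<in>UNIV. \<Sum>j\<in>UNIV. \<Sum>k\<in>UNIV. \<Sum>l\<in>UNIV.
     hinv (g z) i j * hinv (g z) k l * chern_curv g i j k l z)"

definition scalar_curv_hat :: "('n::finite cvec \<Rightarrow> 'n cmat) \<Rightarrow> 'n cvec \<Rightarrow> complex" where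
  "scalar_curv_hat g z = (\<Sum>i\<in>UNIV. \<Sum>j\<in>UNIV. \<Sum>k\<in>UNIV. \<Sum>l\<in>UNIV.
     hinv (g z) i l * hinv (g z) k j * chern_curv g i j k l z)"


section \<open>Differential forms in a coordinate chart\<close>

text \<open>A complex exterior form on complex \<open>n\<close>-space is given by its coefficients: \<open>a I J\<close> is the
  coefficient of \<open>dz\<^sup>I \<and> dzbar\<^sup>J\<close>, where the factors of \<open>dz\<^sup>I\<close> and of \<open>dzbar\<^sup>J\<close> are taken in increasing
  order of the indices. The linear order of the index type serves only this purpose.\<close>
type_synonym 'n form = "'n set \<Rightarrow> 'n set \<Rightarrow> complex"

text \<open>\<open>dz\<^sup>P \<and> dz\<^sup>Q = shuffle_sign P Q \<cdot> dz\<^bsup>P \<union> Q\<^esup>\<close> for disjoint \<open>P\<close>, \<open>Q\<close>.\<close>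
definition shuffle_sign :: "'n::linorder set \<Rightarrow> 'n set \<Rightarrow> complex" where
  "shuffle_sign P Q = (- 1) ^ card {(i, j). i \<in> P \<and> j \<in> Q \<and> j < i}"

text \<open>The factor \<open>(- 1) ^ (card Q * card (I - P))\<close> comes from moving \<open>dz\<^bsup>I - P\<^esup>\<close> past \<open>dzbar\<^sup>Q\<close>.\<close>
definition wedge :: "'n::{finite,linorder} form \<Rightarrow> 'n form \<Rightarrow> 'n form" (infixr "\<and>\<^sub>f" 70) where
  "a \<and>\<^sub>f b = (\<lambda>I J. \<Sum>P\<in>Pow I. \<Sum>Q\<in>Pow J.
     (- 1) ^ (card Q * card (I - P)) * shuffle_sign P (I - P) * shuffle_sign Q (J - Q)
       * a P Q * b (I - P) (J - Q))"

definition one_form :: "'n form" where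
  "one_form = (\<lambda>I J. if I = {} \<and> J = {} then 1 else 0)"

primrec wedge_power :: "'n::{finite,linorder} form \<Rightarrow> nat \<Rightarrow> 'n form" where
  "wedge_power a 0 = one_form"
| "wedge_power a (Suc k) = a \<and>\<^sub>f wedge_power a k"

definition dz :: "'n \<Rightarrow> 'n form" where
  "dz i = (\<lambda>I J. if I = {i} \<and> J = {} then 1 else 0)"

definition dzbar :: "'n \<Rightarrow> 'n form" where
  "dzbar i = (\<lambda>I J. if I = {} \<and> J = {i} then 1 else 0)"

text \<open>The Dolbeault operators \<open>\<partial>\<close> and \<open>\<partial>\<close>-bar; the Wirtinger derivatives act on coefficients.\<close>
definition del :: "('n cvec \<Rightarrow> 'n form) \<Rightarrow> 'n cvec \<Rightarrow> 'n::{finite,linorder} form" where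
  "del \<alpha> z = (\<lambda>I J. \<Sum>i\<in>UNIV. (dz i \<and>\<^sub>f (\<lambda>P Q. pd i (\<lambda>y. \<alpha> y P Q) z)) I J)"

definition delbar :: "('n cvec \<Rightarrow> 'n form) \<Rightarrow> 'n cvec \<Rightarrow> 'n::{finite,linorder} form" where
  "delbar \<alpha> z = (\<lambda>I J. \<Sum>i\<in>UNIV. (dzbar i \<and>\<^sub>f (\<lambda>P Q. pdbar i (\<lambda>y. \<alpha> y P Q) z)) I J)"

definition fundamental_form ::
    "('n cvec \<Rightarrow> 'n cmat) \<Rightarrow> 'n cvec \<Rightarrow> 'n::{finite,linorder} form" where
  "fundamental_form g z =
     (\<lambda>I J. \<Sum>i\<in>UNIV. \<Sum>j\<in>UNIV. \<i> * g z $ i $ j * (dz i \<and>\<^sub>f dzbar j) I J)"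

definition ddbar_power ::
    "('n cvec \<Rightarrow> 'n cmat) \<Rightarrow> nat \<Rightarrow> 'n cvec \<Rightarrow> 'n::{finite,linorder} form" where
  "ddbar_power g k = del (delbar (\<lambda>z. wedge_power (fundamental_form g z) k))"

definition k_gauduchon :: "('a, 'n::{finite,linorder}) chart set \<Rightarrow>
    (('a, 'n) chart \<Rightarrow> 'n cvec \<Rightarrow> 'n cmat) \<Rightarrow> nat \<Rightarrow> bool" where
  "k_gauduchon A h k \<longleftrightarrow> (\<forall>c\<in>A. \<forall>p\<in>fst c.
     ddbar_power (h c) k (snd c p)
       \<and>\<^sub>f wedge_power (fundamental_form (h c) (snd c p)) (CARD('n) - k - 1) = (\<lambda>I J. 0))"

definition pluriclosed :: "('a, 'n::{finite,linorder}) chart set \<Rightarrow>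
    (('a, 'n) chart \<Rightarrow> 'n cvec \<Rightarrow> 'n cmat) \<Rightarrow> bool" where
  "pluriclosed A h \<longleftrightarrow> (\<forall>c\<in>A. \<forall>p\<in>fst c.
     del (delbar (fundamental_form (h c))) (snd c p) = (\<lambda>I J. 0))"

definition astheno_kaehler :: "('a, 'n::{finite,linorder}) chart set \<Rightarrow>
    (('a, 'n) chart \<Rightarrow> 'n cvec \<Rightarrow> 'n cmat) \<Rightarrow> bool" where
  "astheno_kaehler A h \<longleftrightarrow> (\<forall>c\<in>A. \<forall>p\<in>fst c.
     ddbar_power (h c) (CARD('n) - 2) (snd c p) = (\<lambda>I J. 0))"

text \<open>The inequality is required in every chart around every point; the scalar curvatures do not
  depend on the chart.\<close>
definition scalar_curv_ge_hat :: "('a, 'n::finite) chart set \<Rightarrow>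
    (('a, 'n) chart \<Rightarrow> 'n cvec \<Rightarrow> 'n cmat) \<Rightarrow> bool" where
  "scalar_curv_ge_hat A h \<longleftrightarrow> (\<forall>c\<in>A. \<forall>p\<in>fst c.
     scalar_curv (h c) (snd c p) \<ge> scalar_curv_hat (h c) (snd c p))"

end

theory Submission
  imports Defs
begin

text \<open>
  Write \<open>T\<close> for the torsion of the Chern connection and \<open>\<tau>\<close> for its trace. The definitions give
  \<open>s - \<close>s-hat\<open> = \<bar>T\<bar>\<^sup>2/2 - D\<close>, where \<open>D\<close> is the difference of the two traces of the mixed second
  derivatives of the metric. On the other hand, with lower indices of \<open>\<omega>\<close> for derivatives of its
  coefficients, applying \<open>\<partial>\<close> and \<open>\<partial>\<close>-bar to \<open>\<omega>\<^sup>k\<close> gives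
  \<open>k \<Sum> dz\<^sup>i \<and> dzbar\<^sup>j \<and> (\<omega>\<^bsub>ij\<^esub> \<and> \<omega>\<^bsup>k-1\<^esup> + (k - 1) \<omega>\<^sub>i \<and> \<omega>\<^sub>j \<and> \<omega>\<^bsup>k-2\<^esup>)\<close>. Multiplied by
  \<open>\<omega>\<^bsup>n-k-1\<^esup>\<close> this has top degree. Contracting forms that vanish because they have degree \<open>n + 1\<close>
  in the \<open>dz\<close> with the vectors of a unitary frame evaluates it, up to a nonzero factor, as
  \<open>(n - 2) D + (k - 1) (\<bar>\<tau>\<bar>\<^sup>2 - \<bar>T\<bar>\<^sup>2/2)\<close> times \<open>\<omega>\<^sup>n\<close>. Hence a \<open>k\<close>-Gauduchon metric satisfies
  \<open>s - \<close>s-hat\<open> = (1 - c) \<bar>T\<bar>\<^sup>2/2 + c \<bar>\<tau>\<bar>\<^sup>2\<close> with \<open>c = (k - 1)/(n - 2) \<in> [0, 1]\<close>.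
\<close>

section \<open>The exterior algebra as a ring\<close>

text \<open>The inequality is pointwise, so the unitary frame is produced by linear algebra at a
  single point and never differentiated: derivatives stay in coordinates, and only their values at
  the point are expanded in the frame. There the torsion with lowered index is the
  antisymmetrisation \<open>A m t r - A t m r\<close> of the first derivatives of the metric.

  One contraction of a vanishing form trades a factor dz \<and> dzbar of the coframe for a Kronecker
  delta and yields a number from the power rule. Two or three such factors against a power of
  \<omega> therefore give a 2 x 2 or 3 x 3 determinant of deltas, divided by n (n - 1) or by n (n -
  1) (n - 2). The quotient of these two numbers is the n - 2 in the denominator of c. The range 1
  \<le> k \<le> n - 1 is exactly 0 \<le> c \<le> 1, which makes the final expression a convex
  combination of two nonnegative quantities.\<close>

lemma shuffle_sign_empty [simp]: "shuffle_sign {} Q = 1" "shuffle_sign P {} = 1"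
  by (simp_all add: shuffle_sign_def)

lemma shuffle_sign_Un_left:
  fixes P Q R :: "'n::{finite,linorder} set"
  assumes "P \<inter> Q = {}"
  shows "shuffle_sign (P \<union> Q) R = shuffle_sign P R * shuffle_sign Q R"
proof -
  have "{(i, j). i \<in> P \<union> Q \<and> j \<in> R \<and> j < i} =
      {(i, j). i \<in> P \<and> j \<in> R \<and> j < i} \<union> {(i, j). i \<in> Q \<and> j \<in> R \<and> j < i}"
    by auto
  moreover have "{(i, j). i \<in> P \<and> j \<in> R \<and> j < i} \<inter> {(i, j). i \<in> Q \<and> j \<in> R \<and> j < i} = {}"
    using assms by auto
  ultimately show ?thesis
    by (simp add: shuffle_sign_def card_Un_disjoint power_add)
qed

lemma shuffle_sign_Un_right:
  fixes P Q R :: "'n::{finite,linorder} set"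
  assumes "Q \<inter> R = {}"
  shows "shuffle_sign P (Q \<union> R) = shuffle_sign P Q * shuffle_sign P R"
proof -
  have "{(i, j). i \<in> P \<and> j \<in> Q \<union> R \<and> j < i} =
      {(i, j). i \<in> P \<and> j \<in> Q \<and> j < i} \<union> {(i, j). i \<in> P \<and> j \<in> R \<and> j < i}"
    by auto
  moreover have "{(i, j). i \<in> P \<and> j \<in> Q \<and> j < i} \<inter> {(i, j). i \<in> P \<and> j \<in> R \<and> j < i} = {}"
    using assms by auto
  ultimately show ?thesis
    by (simp add: shuffle_sign_def card_Un_disjoint power_add)
qed

lemma shuffle_sign_singletons:
  "shuffle_sign {i} {j} = (if j < i then - 1 else 1)"
proof -
  have "{(a, b). a \<in> {i} \<and> b \<in> {j} \<and> b < a} = (if j < i then {(i, j)} else {})"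
    by auto
  then show ?thesis
    by (simp add: shuffle_sign_def)
qed

lemma shuffle_sign_insert_right:
  fixes Q :: "'n::{finite,linorder} set"
  assumes "j \<notin> Q"
  shows "shuffle_sign {i} (insert j Q) = (if j < i then - 1 else 1) * shuffle_sign {i} Q"
  using shuffle_sign_Un_right[of "{j}" Q "{i}"] assms by (simp add: shuffle_sign_singletons)

lemma shuffle_sign_square [simp]: "shuffle_sign P Q * shuffle_sign P Q = 1"
  by (simp add: shuffle_sign_def flip: power_mult_distrib)

lemma shuffle_sign_nonzero [simp]: "shuffle_sign P Q \<noteq> 0"
  by (simp add: shuffle_sign_def)

text \<open>Both sides run over the ordered partitions of \<open>I\<close> into three blocks; the
  left one chooses the union of the first two blocks before splitting it.\<close>

lemma sum_nested_subsets:
  fixes f :: "'n::finite set \<Rightarrow> 'n set \<Rightarrow> 'n set \<Rightarrow> 'b::comm_monoid_add"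
  shows "(\<Sum>P\<in>Pow I. \<Sum>R\<in>Pow P. f R (P - R) (I - P)) =
    (\<Sum>R\<in>Pow I. \<Sum>S\<in>Pow (I - R). f R S (I - R - S))"
proof -
  have "(\<Sum>P\<in>Pow I. \<Sum>R\<in>Pow P. f R (P - R) (I - P)) =
      (\<Sum>(P, R)\<in>Sigma (Pow I) Pow. f R (P - R) (I - P))"
    by (simp add: sum.Sigma)
  also have "\<dots> = (\<Sum>(R, S)\<in>Sigma (Pow I) (\<lambda>R. Pow (I - R)). f R S (I - R - S))"
    by (rule sum.reindex_bij_witness[where i = "\<lambda>(R, S). (R \<union> S, R)" and j = "\<lambda>(P, R). (R, P - R)"])
      (auto intro!: arg_cong3[where f = f])
  also have "\<dots> = (\<Sum>R\<in>Pow I. \<Sum>S\<in>Pow (I - R). f R S (I - R - S))"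
    by (simp add: sum.Sigma)
  finally show ?thesis .
qed

text \<open>Either bracketing is a sum of the same terms \<open>F\<close> over the ordered
  partitions of \<open>I\<close> and \<open>J\<close> into three blocks. The signs agree because
  \<open>shuffle_sign\<close> is multiplicative over disjoint unions in each argument.\<close>

lemma wedge_assoc:
  fixes a b c :: "'n::{finite,linorder} form"
  shows "(a \<and>\<^sub>f b) \<and>\<^sub>f c = a \<and>\<^sub>f (b \<and>\<^sub>f c)"
proof (intro ext)
  fix I J :: "'n set"
  \<comment> \<open>The exponent counts the transpositions that move each dz block to the left past
    the dzbar blocks of the earlier factors; the shuffle signs then sort the blocks
    pairwise.\<close>
  define F where "F R S T R' S' T' =
    (- 1) ^ (card R' * card S + card R' * card T + card S' * card T) *
    (shuffle_sign R S * shuffle_sign R T * shuffle_sign S T) *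
    (shuffle_sign R' S' * shuffle_sign R' T' * shuffle_sign S' T') *
    (a R R' * b S S' * c T T')" for R S T R' S' T' :: "'n set"
  have L: "(- 1) ^ (card Q * card (I - P)) * shuffle_sign P (I - P) * shuffle_sign Q (J - Q)
       * (\<Sum>R\<in>Pow P. \<Sum>R'\<in>Pow Q.
          (- 1) ^ (card R' * card (P - R)) * shuffle_sign R (P - R) * shuffle_sign R' (Q - R')
           * a R R' * b (P - R) (Q - R')) * c (I - P) (J - Q)
      = (\<Sum>R\<in>Pow P. \<Sum>R'\<in>Pow Q. F R (P - R) (I - P) R' (Q - R') (J - Q))"
    if "P \<subseteq> I" "Q \<subseteq> J" for P Q
    unfolding sum_distrib_left sum_distrib_right
  proof (intro sum.cong refl)
    fix R R' assume R: "R \<in> Pow P" "R' \<in> Pow Q"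
    then have "shuffle_sign P (I - P) = shuffle_sign R (I - P) * shuffle_sign (P - R) (I - P)"
      using shuffle_sign_Un_left[of R "P - R" "I - P"] by (simp add: Un_absorb1)
    moreover have "shuffle_sign Q (J - Q) = shuffle_sign R' (J - Q) * shuffle_sign (Q - R') (J - Q)"
      using shuffle_sign_Un_left[of R' "Q - R'" "J - Q"] R by (simp add: Un_absorb1)
    moreover have "card Q = card R' + card (Q - R')"
      using R by (simp add: card_Diff_subset card_mono)
    ultimately show "(- 1) ^ (card Q * card (I - P)) * shuffle_sign P (I - P) * shuffle_sign Q (J - Q)
       * ((- 1) ^ (card R' * card (P - R)) * shuffle_sign R (P - R) * shuffle_sign R' (Q - R')
           * a R R' * b (P - R) (Q - R')) * c (I - P) (J - Q)
         = F R (P - R) (I - P) R' (Q - R') (J - Q)"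
      unfolding F_def by (simp add: power_add algebra_simps)
  qed
  have R: "(- 1) ^ (card R' * card (I - R)) * shuffle_sign R (I - R) * shuffle_sign R' (J - R') * a R R' *
     (\<Sum>S\<in>Pow (I - R). \<Sum>S'\<in>Pow (J - R').
         (- 1) ^ (card S' * card (I - R - S)) * shuffle_sign S (I - R - S) *
         shuffle_sign S' (J - R' - S') * b S S' * c (I - R - S) (J - R' - S'))
    = (\<Sum>S\<in>Pow (I - R). \<Sum>S'\<in>Pow (J - R'). F R S (I - R - S) R' S' (J - R' - S'))"
    if "R \<subseteq> I" "R' \<subseteq> J" for R R'
    unfolding sum_distrib_left sum_distrib_right
  proof (intro sum.cong refl)
    fix S S' assume S: "S \<in> Pow (I - R)" "S' \<in> Pow (J - R')"
    then have "shuffle_sign R (I - R) = shuffle_sign R S * shuffle_sign R (I - R - S)"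
      using shuffle_sign_Un_right[of S "I - R - S" R] by (simp add: Un_absorb1)
    moreover have "shuffle_sign R' (J - R') = shuffle_sign R' S' * shuffle_sign R' (J - R' - S')"
      using shuffle_sign_Un_right[of S' "J - R' - S'" R'] S by (simp add: Un_absorb1)
    moreover have "card (I - R) = card S + card (I - R - S)"
      using S by (simp add: card_Diff_subset card_mono)
    ultimately show "(- 1) ^ (card R' * card (I - R)) * shuffle_sign R (I - R) * shuffle_sign R' (J - R')
      * a R R' * ((- 1) ^ (card S' * card (I - R - S)) * shuffle_sign S (I - R - S) *
         shuffle_sign S' (J - R' - S') * b S S' * c (I - R - S) (J - R' - S'))
      = F R S (I - R - S) R' S' (J - R' - S')"
      unfolding F_def by (simp add: power_add algebra_simps)
  qed
  have "((a \<and>\<^sub>f b) \<and>\<^sub>f c) I J =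
      (\<Sum>P\<in>Pow I. \<Sum>Q\<in>Pow J. \<Sum>R\<in>Pow P. \<Sum>R'\<in>Pow Q. F R (P - R) (I - P) R' (Q - R') (J - Q))"
    unfolding wedge_def by (intro sum.cong refl L) auto
  also have "\<dots> = (\<Sum>P\<in>Pow I. \<Sum>R\<in>Pow P. \<Sum>Q\<in>Pow J. \<Sum>R'\<in>Pow Q. F R (P - R) (I - P) R' (Q - R') (J - Q))"
    by (intro sum.cong refl sum.swap)
  also have "\<dots> = (\<Sum>R\<in>Pow I. \<Sum>S\<in>Pow (I - R). \<Sum>R'\<in>Pow J. \<Sum>S'\<in>Pow (J - R').
      F R S (I - R - S) R' S' (J - R' - S'))"
    unfolding sum_nested_subsets[where I = I, of "\<lambda>R S T. \<Sum>Q\<in>Pow J. \<Sum>R'\<in>Pow Q. F R S T R' (Q - R') (J - Q)"]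
    by (intro sum.cong refl sum_nested_subsets)
  also have "\<dots> = (\<Sum>R\<in>Pow I. \<Sum>R'\<in>Pow J. \<Sum>S\<in>Pow (I - R). \<Sum>S'\<in>Pow (J - R').
      F R S (I - R - S) R' S' (J - R' - S'))"
    by (intro sum.cong refl sum.swap)
  also have "\<dots> = (a \<and>\<^sub>f (b \<and>\<^sub>f c)) I J"
    unfolding wedge_def by (intro sum.cong refl R[symmetric]) auto
  finally show "((a \<and>\<^sub>f b) \<and>\<^sub>f c) I J = (a \<and>\<^sub>f (b \<and>\<^sub>f c)) I J" .
qed

lemma sum_Pow_single:
  fixes f :: "'n::finite set \<Rightarrow> 'b::comm_monoid_add"
  assumes "\<And>P. P \<subseteq> I \<Longrightarrow> P \<noteq> K \<Longrightarrow> f P = 0"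
  shows "(\<Sum>P\<in>Pow I. f P) = (if K \<subseteq> I then f K else 0)"
proof (cases "K \<subseteq> I")
  case True
  have "(\<Sum>P\<in>Pow I. f P) = (\<Sum>P\<in>Pow I. if P = K then f K else 0)"
    using assms by (intro sum.cong refl) auto
  with True show ?thesis
    by (simp add: sum.delta)
next
  case False
  then show ?thesis
    using assms by (auto intro!: sum.neutral)
qed

lemma one_form_wedge:
  fixes a :: "'n::{finite,linorder} form"
  shows "one_form \<and>\<^sub>f a = a"
proof (intro ext)
  fix I J
  show "(one_form \<and>\<^sub>f a) I J = a I J"
    unfolding wedge_def one_form_def
    by (subst sum_Pow_single[where K = "{}"], simp, subst sum_Pow_single[where K = "{}"]) auto
qed

lemma wedge_one_form:
  fixes a :: "'n::{finite,linorder} form"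
  shows "a \<and>\<^sub>f one_form = a"
proof (intro ext)
  fix I J
  show "(a \<and>\<^sub>f one_form) I J = a I J"
    unfolding wedge_def one_form_def
    by (subst sum_Pow_single[where K = I], auto, subst sum_Pow_single[where K = J]) auto
qed

lemma dz_wedge:
  fixes a :: "'n::{finite,linorder} form"
  shows "(dz i \<and>\<^sub>f a) I J =
    (if i \<in> I then shuffle_sign {i} (I - {i}) * a (I - {i}) J else 0)"
  unfolding wedge_def dz_def
  by (subst sum_Pow_single[where K = "{i}"], simp, subst sum_Pow_single[where K = "{}"]) auto

lemma dzbar_wedge:
  fixes a :: "'n::{finite,linorder} form"
  shows "(dzbar j \<and>\<^sub>f a) I J =
    (if j \<in> J then (- 1) ^ card I * shuffle_sign {j} (J - {j}) * a I (J - {j}) else 0)"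
  unfolding wedge_def dzbar_def
  by (subst sum_Pow_single[where K = "{}"], simp, subst sum_Pow_single[where K = "{j}"]) auto

text \<open>A copy of the forms as a type of its own, so that the wedge product becomes the
  multiplication of a noncommutative ring and powers, sums and distributivity come from the class
  \<open>ring_1\<close>.\<close>

typedef 'n ext = "UNIV :: 'n form set"
  morphisms coeff Ext ..

setup_lifting type_definition_ext

instantiation ext :: (type) ab_group_add
begin
lift_definition zero_ext :: "'a ext" is "\<lambda>I J. 0" .
lift_definition plus_ext :: "'a ext \<Rightarrow> 'a ext \<Rightarrow> 'a ext" is "\<lambda>a b I J. a I J + b I J" .
lift_definition minus_ext :: "'a ext \<Rightarrow> 'a ext \<Rightarrow> 'a ext" is "\<lambda>a b I J. a I J - b I J" .
lift_definition uminus_ext :: "'a ext \<Rightarrow> 'a ext" is "\<lambda>a I J. - a I J" .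
instance
  by standard (transfer; simp add: algebra_simps fun_eq_iff)+
end

instantiation ext :: ("{finite,linorder}") ring_1
begin
lift_definition one_ext :: "'a ext" is one_form .
lift_definition times_ext :: "'a ext \<Rightarrow> 'a ext \<Rightarrow> 'a ext" is wedge .
instance
proof
  fix a b c :: "'a ext"
  show "a * b * c = a * (b * c)" by transfer (rule wedge_assoc)
  show "1 * a = a" by transfer (rule one_form_wedge)
  show "a * 1 = a" by transfer (rule wedge_one_form)
  show "(a + b) * c = a * c + b * c"
    by transfer (simp add: wedge_def fun_eq_iff algebra_simps sum.distrib)
  show "a * (b + c) = a * b + a * c"
    by transfer (simp add: wedge_def fun_eq_iff algebra_simps sum.distrib)
  show "(0 :: 'a ext) \<noteq> 1"
    by transfer (auto simp: one_form_def fun_eq_iff)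
qed
end

lift_definition smul :: "complex \<Rightarrow> 'n ext \<Rightarrow> 'n ext" is "\<lambda>c a I J. c * a I J" .

global_interpretation ext: vector_space smul
  by standard (transfer; simp add: algebra_simps)+

lemma smul_mult_left [simp]: "smul c x * y = smul c (x * y)"
  by transfer (simp add: wedge_def sum_distrib_left algebra_simps)

lemma smul_mult_right [simp]: "x * smul c y = smul c (x * y)"
  by transfer (simp add: wedge_def sum_distrib_left algebra_simps)

lift_definition dzE :: "'n \<Rightarrow> 'n ext" is dz .
lift_definition dzbarE :: "'n \<Rightarrow> 'n ext" is dzbar .

lemma coeff_simps [simp]:
  "coeff 0 I J = 0" "coeff (x + y) I J = coeff x I J + coeff y I J"
  "coeff (x - y) I J = coeff x I J - coeff y I J" "coeff (- x) I J = - coeff x I J"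
  "coeff (smul c x) I J = c * coeff x I J"
  by (transfer; simp)+

lemma coeff_sum: "coeff (\<Sum>i\<in>A. f i) I J = (\<Sum>i\<in>A. coeff (f i) I J)"
  by (induction A rule: infinite_finite_induct) simp_all

lemma ext_eqI: "(\<And>I J. coeff x I J = coeff y I J) \<Longrightarrow> x = y"
  by transfer auto

lemma coeff_dzE_mult:
  fixes x :: "'n::{finite,linorder} ext"
  shows "coeff (dzE i * x) I J =
    (if i \<in> I then shuffle_sign {i} (I - {i}) * coeff x (I - {i}) J else 0)"
  by transfer (rule dz_wedge)

lemma coeff_dzbarE_mult:
  fixes x :: "'n::{finite,linorder} ext"
  shows "coeff (dzbarE j * x) I J =
    (if j \<in> J then (- 1) ^ card I * shuffle_sign {j} (J - {j}) * coeff x I (J - {j}) else 0)"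
  by transfer (rule dzbar_wedge)

text \<open>Exactly one of \<open>i\<close> and \<open>k\<close> precedes the other, so exactly one
  of the two orders of removal picks up an extra sign.\<close>

lemma shuffle_sign_swap:
  fixes I :: "'n::{finite,linorder} set"
  assumes "i \<in> I" "k \<in> I" "i \<noteq> k"
  shows "shuffle_sign {i} (I - {i}) * shuffle_sign {k} (I - {i} - {k}) =
    - (shuffle_sign {k} (I - {k}) * shuffle_sign {i} (I - {k} - {i}))"
proof -
  define L where "L = I - {i, k}"
  have L: "k \<notin> L" "i \<notin> L" and "I - {i} = insert k L" "I - {k} = insert i L"
    using assms unfolding L_def by auto
  moreover have "insert k L - {k} = L" "insert i L - {i} = L"
    using L by simp_all
  ultimately have "shuffle_sign {i} (I - {i}) * shuffle_sign {k} (I - {i} - {k}) =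
      (if k < i then - 1 else 1) * (shuffle_sign {i} L * shuffle_sign {k} L)"
    "shuffle_sign {k} (I - {k}) * shuffle_sign {i} (I - {k} - {i}) =
      (if i < k then - 1 else 1) * (shuffle_sign {i} L * shuffle_sign {k} L)"
    by (simp_all only: shuffle_sign_insert_right L not_False_eq_True mult_ac)
  with assms(3) show ?thesis
    by (simp only: split: if_split) (auto simp: not_less)
qed

text \<open>Coefficients are easy to read off for left multiplication by a generator, so the
  anticommutation relations are checked on an arbitrary right factor.\<close>

lemma anticommute_of_left_mult:
  fixes x y :: "'n::{finite,linorder} ext"
  assumes "\<And>w. x * (y * w) = - (y * (x * w))"
  shows "x * y = - (y * x)"
  using assms[of 1] by simp

lemma dzE_anticommute:
  fixes i k :: "'n::{finite,linorder}"
  shows "dzE i * dzE k = - (dzE k * dzE i)"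
proof (rule anticommute_of_left_mult, rule ext_eqI)
  fix w :: "'n ext" and I J :: "'n set"
  have "shuffle_sign {i} (I - {i}) * (shuffle_sign {k} (I - {i} - {k}) * c) =
    - (shuffle_sign {k} (I - {k}) * (shuffle_sign {i} (I - {k} - {i}) * c))"
    if "i \<in> I" "k \<in> I" "i \<noteq> k" for c
    using shuffle_sign_swap[OF that] by (simp flip: mult.assoc)
  moreover have "I - {i} - {k} = I - {k} - {i}"
    by auto
  ultimately show "coeff (dzE i * (dzE k * w)) I J = coeff (- (dzE k * (dzE i * w))) I J"
    by (cases "i = k") (simp_all add: coeff_dzE_mult)
qed

lemma dzbarE_anticommute:
  fixes i k :: "'n::{finite,linorder}"
  shows "dzbarE i * dzbarE k = - (dzbarE k * dzbarE i)"
proof (rule anticommute_of_left_mult, rule ext_eqI)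
  fix w :: "'n ext" and I J :: "'n set"
  define e :: complex where "e = (- 1) ^ card I"
  have "e * shuffle_sign {i} (J - {i}) * (e * shuffle_sign {k} (J - {i} - {k}) * c) =
    - (e * shuffle_sign {k} (J - {k}) * (e * shuffle_sign {i} (J - {k} - {i}) * c))"
    if "i \<in> J" "k \<in> J" "i \<noteq> k" for c
  proof -
    have "e * shuffle_sign {i} (J - {i}) * (e * shuffle_sign {k} (J - {i} - {k}) * c) =
        (shuffle_sign {i} (J - {i}) * shuffle_sign {k} (J - {i} - {k})) * (e * e * c)"
      by (simp add: mult_ac)
    then show ?thesis
      unfolding shuffle_sign_swap[OF that] by (simp add: mult_ac)
  qed
  moreover have "J - {i} - {k} = J - {k} - {i}"
    by auto
  ultimately show "coeff (dzbarE i * (dzbarE k * w)) I J = coeff (- (dzbarE k * (dzbarE i * w))) I J"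
    unfolding coeff_dzbarE_mult coeff_simps e_def[symmetric]
    by (cases "i = k") simp_all
qed

lemma dzE_dzbarE_anticommute:
  fixes i k :: "'n::{finite,linorder}"
  shows "dzE i * dzbarE k = - (dzbarE k * dzE i)"
proof (rule anticommute_of_left_mult, rule ext_eqI)
  fix w :: "'n ext" and I J :: "'n set"
  show "coeff (dzE i * (dzbarE k * w)) I J = coeff (- (dzbarE k * (dzE i * w))) I J"
  proof (cases "i \<in> I")
    case True
    have "card I = Suc (card (I - {i}))"
      using True by (intro card_Suc_Diff1[symmetric]) simp_all
    then have power_I: "(- 1 :: complex) ^ card I = - 1 * ((- 1) ^ card (I - {i}))"
      by (simp only: power_Suc)
    define e :: complex where "e = (- 1) ^ card (I - {i})"
    show ?thesis
      using True unfolding coeff_dzbarE_mult coeff_dzE_mult coeff_simps power_I e_def[symmetric]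
      by simp
  qed (simp add: coeff_dzbarE_mult coeff_dzE_mult)
qed

section \<open>Interior products with the holomorphic coordinate vectors\<close>

lift_definition contr :: "'n::linorder \<Rightarrow> 'n ext \<Rightarrow> 'n ext" is
  "\<lambda>m a I J. if m \<in> I then 0 else shuffle_sign {m} I * a (insert m I) J" .

lemma coeff_contr: "coeff (contr m x) I J =
    (if m \<in> I then 0 else shuffle_sign {m} I * coeff x (insert m I) J)"
  by transfer simp

lemma contr_add: "contr m (x + y) = contr m x + contr m y"
  by (rule ext_eqI) (simp add: coeff_contr algebra_simps)

lemma contr_smul: "contr m (smul c x) = smul c (contr m x)"
  by (rule ext_eqI) (simp add: coeff_contr)

lemma contr_one: "contr m 1 = 0"
  by transfer (auto simp: one_form_def fun_eq_iff)

text \<open>The antiderivation rule. Signs need care only when \<open>i\<close> is in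
  \<open>I\<close> and \<open>m\<close> is not: there the two orders of inserting \<open>m\<close>
  and removing \<open>i\<close> differ by the comparison of \<open>m\<close> with
  \<open>i\<close>.\<close>

lemma contr_dzE_mult:
  fixes x :: "'n::{finite,linorder} ext"
  shows "contr m (dzE i * x) = (if m = i then x else 0) - dzE i * contr m x"
proof (rule ext_eqI)
  fix I J
  consider "m = i" | "m \<noteq> i" "i \<notin> I" | "m \<noteq> i" "i \<in> I" "m \<in> I" | "m \<noteq> i" "i \<in> I" "m \<notin> I"
    by blast
  then show "coeff (contr m (dzE i * x)) I J =
      coeff ((if m = i then x else 0) - dzE i * contr m x) I J"
  proof cases
    case 1
    then show ?thesis
      by (auto simp: coeff_contr coeff_dzE_mult insert_absorb simp flip: mult.assoc)
  next
    case 4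
    define L where "L = I - {i}"
    have I: "I = insert i L" and L: "i \<notin> L" "m \<notin> L"
      using 4 by (auto simp: L_def)
    have D: "insert m (insert i L) - {i} = insert m L" "insert i L - {i} = L"
      using L 4 by auto
    have "coeff (contr m (dzE i * x)) I J =
        shuffle_sign {m} (insert i L) * (shuffle_sign {i} (insert m L) * coeff x (insert m L) J)"
      using 4 unfolding I coeff_contr coeff_dzE_mult D by simp
    moreover have "coeff (dzE i * contr m x) I J =
        shuffle_sign {i} L * (shuffle_sign {m} L * coeff x (insert m L) J)"
      using L unfolding I coeff_contr coeff_dzE_mult D by simp
    ultimately show ?thesis
      using 4 L by (auto simp: shuffle_sign_insert_right)
  qed (auto simp: coeff_contr coeff_dzE_mult)
qed

text \<open>The sign arises because \<open>contr m\<close> changes the number of dz, which dzbar has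
  to pass, by one.\<close>

lemma contr_dzbarE_mult:
  fixes x :: "'n::{finite,linorder} ext"
  shows "contr m (dzbarE j * x) = - (dzbarE j * contr m x)"
  by (rule ext_eqI) (auto simp: coeff_contr coeff_dzbarE_mult)

section \<open>Number of holomorphic factors\<close>

definition hol_degree :: "nat \<Rightarrow> 'n ext \<Rightarrow> bool" where
  "hol_degree p x \<longleftrightarrow> (\<forall>I J. coeff x I J \<noteq> 0 \<longrightarrow> card I = p)"

lemma hol_degree_zero: "hol_degree p 0"
  by (simp add: hol_degree_def)

lemma hol_degree_add: "hol_degree p x \<Longrightarrow> hol_degree p y \<Longrightarrow> hol_degree p (x + y)"
  unfolding hol_degree_def coeff_simps by (metis add.right_neutral)

lemma hol_degree_sum: "(\<And>i. i \<in> A \<Longrightarrow> hol_degree p (f i)) \<Longrightarrow> hol_degree p (\<Sum>i\<in>A. f i)"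
  by (induction A rule: infinite_finite_induct) (auto intro: hol_degree_add hol_degree_zero)

lemma hol_degree_smul: "hol_degree p x \<Longrightarrow> hol_degree p (smul c x)"
  by (simp add: hol_degree_def)

lemma hol_degree_one: "hol_degree 0 (1 :: 'n::{finite,linorder} ext)"
  unfolding hol_degree_def by transfer (simp add: one_form_def)

lemma hol_degree_dzE: "hol_degree 1 (dzE i)"
  unfolding hol_degree_def by transfer (simp add: dz_def)

lemma hol_degree_dzbarE: "hol_degree 0 (dzbarE i)"
  unfolding hol_degree_def by transfer (simp add: dzbar_def)

lemma hol_degree_mult:
  fixes x y :: "'n::{finite,linorder} ext"
  assumes "hol_degree p x" "hol_degree q y"
  shows "hol_degree (p + q) (x * y)"
  unfolding hol_degree_def
proof (intro allI impI)
  fix I J assume "coeff (x * y) I J \<noteq> 0"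
  then have "(\<Sum>P\<in>Pow I. \<Sum>Q\<in>Pow J.
     (- 1) ^ (card Q * card (I - P)) * shuffle_sign P (I - P) * shuffle_sign Q (J - Q)
       * coeff x P Q * coeff y (I - P) (J - Q)) \<noteq> 0"
    by (simp add: times_ext.rep_eq wedge_def)
  then obtain P Q where "P \<subseteq> I" "coeff x P Q \<noteq> 0" "coeff y (I - P) (J - Q) \<noteq> 0"
    by (metis (no_types, lifting) PowD mult_eq_0_iff sum.neutral)
  then show "card I = p + q"
    using assms unfolding hol_degree_def
    by (metis card_Diff_subset card_mono finite le_add_diff_inverse)
qed

lemma hol_degree_power:
  fixes x :: "'n::{finite,linorder} ext"
  shows "hol_degree p x \<Longrightarrow> hol_degree (k * p) (x ^ k)"
  by (induction k) (auto intro: hol_degree_mult hol_degree_one)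

lemma hol_degree_gt_eq_0:
  fixes x :: "'n::finite ext"
  assumes "hol_degree p x" "p > CARD('n)"
  shows "x = 0"
proof (rule ext_eqI)
  fix I J
  show "coeff x I J = coeff 0 I J"
    using assms card_mono[of UNIV I] unfolding hol_degree_def by fastforce
qed

section \<open>Products of forms in a coframe\<close>

lemma sum_if_zero:
  "(\<Sum>y\<in>A. if P then f y else 0) = (if P then sum f A else (0::'b::comm_monoid_add))"
  by simp

lemma coeff_one: "coeff (1 :: 'n::{finite,linorder} ext) I J = (if I = {} \<and> J = {} then 1 else 0)"
  by transfer (simp add: one_form_def)

text \<open>Such a product is a basis form up to sign. With all indices listed, it is the witness
  against the vanishing of the top power of \<kappa>.\<close>

lemma prod_list_dzbarE_nonzero:
  fixes js :: "'n::{finite,linorder} list"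
  assumes "distinct js"
  shows "coeff (prod_list (map dzbarE js)) {} (set js) \<noteq> 0"
  using assms
  by (induction js) (simp_all add: coeff_one coeff_dzbarE_mult)

abbreviation kronecker :: "'n \<Rightarrow> 'n \<Rightarrow> complex" ("\<delta>") where
  "\<delta> i j \<equiv> (if i = j then 1 else 0)"

lemma kronecker_mult:
  "\<delta> i j * c = (if i = j then c else 0)" "c * \<delta> i j = (if i = j then c else 0)"
  by auto

lemma sum_delta2:
  fixes B :: "'n::finite \<Rightarrow> 'n \<Rightarrow> 'n \<Rightarrow> 'n \<Rightarrow> complex"
  shows "(\<Sum>m\<in>UNIV. \<Sum>q\<in>UNIV. \<Sum>t\<in>UNIV. \<Sum>r\<in>UNIV.
      B m q t r * (\<delta> m q * \<delta> t r - \<delta> q t * \<delta> m r)) =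
    (\<Sum>m\<in>UNIV. \<Sum>t\<in>UNIV. B m m t t) - (\<Sum>m\<in>UNIV. \<Sum>t\<in>UNIV. B m t t m)"
  by (simp add: right_diff_distrib sum_subtractf kronecker_mult if_distrib[of "\<lambda>x. c * x" for c]
      sum_if_zero sum.delta sum.delta' cong: if_cong)

text \<open>One term for each permutation of three letters: this is the 3 x 3 determinant of deltas
  between the slots m, t, x and q, r, y, summed against \<open>A m t r * A' q x y\<close>. For
  conjugate arrays it becomes the squared norm of the torsion trace minus half that of the
  torsion.\<close>

definition torsion_pairing ::
    "('n::finite \<Rightarrow> 'n \<Rightarrow> 'n \<Rightarrow> complex) \<Rightarrow> ('n \<Rightarrow> 'n \<Rightarrow> 'n \<Rightarrow> complex) \<Rightarrow> complex" where
  "torsion_pairing A A' =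
     (\<Sum>m\<in>UNIV. \<Sum>t\<in>UNIV. \<Sum>x\<in>UNIV. A m t t * A' m x x)
   - (\<Sum>m\<in>UNIV. \<Sum>t\<in>UNIV. \<Sum>r\<in>UNIV. A m t r * A' m r t)
   - (\<Sum>m\<in>UNIV. \<Sum>t\<in>UNIV. \<Sum>x\<in>UNIV. A m t m * A' t x x)
   + (\<Sum>m\<in>UNIV. \<Sum>t\<in>UNIV. \<Sum>r\<in>UNIV. A m t r * A' t r m)
   - (\<Sum>m\<in>UNIV. \<Sum>q\<in>UNIV. \<Sum>t\<in>UNIV. A m t t * A' q q m)
   + (\<Sum>m\<in>UNIV. \<Sum>q\<in>UNIV. \<Sum>t\<in>UNIV. A m t m * A' q q t)"

lemma sum_delta3:
  fixes A A' :: "'n::finite \<Rightarrow> 'n \<Rightarrow> 'n \<Rightarrow> complex"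
  shows "(\<Sum>m\<in>UNIV. \<Sum>q\<in>UNIV. \<Sum>t\<in>UNIV. \<Sum>r\<in>UNIV. \<Sum>x\<in>UNIV. \<Sum>y\<in>UNIV.
      A m t r * A' q x y * (\<delta> m q * (\<delta> t r * \<delta> x y - \<delta> r x * \<delta> t y)
        - \<delta> q t * (\<delta> m r * \<delta> x y - \<delta> r x * \<delta> m y)
        - \<delta> q x * (\<delta> m y * \<delta> t r - \<delta> y t * \<delta> m r))) = torsion_pairing A A'"
  by (simp add: right_diff_distrib sum_subtractf kronecker_mult if_distrib[of "\<lambda>x. c * x" for c]
      sum_if_zero sum.delta sum.delta' torsion_pairing_def cong: if_cong)

text \<open>\<open>D m\<close> plays the role of the contraction with the vector dual to \<open>\<theta> m\<close>. For a unitary coframe the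
  fundamental form is \<open>\<i> \<kappa>\<close>.\<close>
locale coframe =
  fixes \<theta> \<theta>b :: "'n::{finite,linorder} \<Rightarrow> 'n ext" and D :: "'n \<Rightarrow> 'n ext \<Rightarrow> 'n ext"
  assumes \<theta>b_anticommute: "\<theta>b i * \<theta>b k = - (\<theta>b k * \<theta>b i)"
    and \<theta>_\<theta>b_anticommute: "\<theta> i * \<theta>b k = - (\<theta>b k * \<theta> i)"
    and hol_degree_\<theta>: "hol_degree 1 (\<theta> i)"
    and hol_degree_\<theta>b: "hol_degree 0 (\<theta>b i)"
    and D_add: "D m (x + y) = D m x + D m y"
    and D_smul: "D m (smul c x) = smul c (D m x)"
    and D_one: "D m 1 = 0"
    and D_\<theta>: "D m (\<theta> i * x) = (if m = i then x else 0) - \<theta> i * D m x"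
    and D_\<theta>b: "D m (\<theta>b i * x) = - (\<theta>b i * D m x)"
begin

definition E :: "'n \<Rightarrow> 'n \<Rightarrow> 'n ext" where "E i j = \<theta> i * \<theta>b j"

definition \<kappa> :: "'n ext" where "\<kappa> = (\<Sum>m\<in>UNIV. E m m)"

lemma D_zero [simp]: "D m 0 = 0"
  using D_smul[of m 0 0] by simp

lemma D_sum: "D m (\<Sum>i\<in>A. f i) = (\<Sum>i\<in>A. D m (f i))"
  by (induction A rule: infinite_finite_induct) (simp_all add: D_add)

lemma E_commute_\<theta>b: "E i j * \<theta>b k = \<theta>b k * E i j"
proof -
  have "E i j * \<theta>b k = - (\<theta> i * \<theta>b k * \<theta>b j)"
    using \<theta>b_anticommute[of j k] by (simp add: E_def mult.assoc)
  also have "\<dots> = \<theta>b k * E i j"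
    using \<theta>_\<theta>b_anticommute[of i k] by (simp add: E_def mult.assoc)
  finally show ?thesis .
qed

lemma E_\<theta>b_left_commute: "E i j * (\<theta>b k * x) = \<theta>b k * (E i j * x)"
  by (simp add: E_commute_\<theta>b flip: mult.assoc)

lemma \<theta>_\<theta>b_mult: "\<theta> i * (\<theta>b j * x) = E i j * x"
  by (simp add: E_def mult.assoc)

text \<open>\<open>E i j\<close> has even degree, so the contraction passes it without a sign. This
  is also why powers of \<kappa> obey the ordinary power rule below.\<close>

lemma D_E: "D m (E i j * x) = (if m = i then \<theta>b j * x else 0) + E i j * D m x"
  by (simp add: E_def mult.assoc D_\<theta> D_\<theta>b)

lemma D_\<kappa>: "D m (\<kappa> * x) = \<theta>b m * x + \<kappa> * D m x"
  by (simp add: \<kappa>_def sum_distrib_right D_sum D_E sum.distrib)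

lemma \<kappa>_commute_\<theta>b: "\<kappa> * \<theta>b k = \<theta>b k * \<kappa>"
  by (simp add: \<kappa>_def sum_distrib_right sum_distrib_left E_commute_\<theta>b)

lemma D_\<kappa>_power: "D m (\<kappa> ^ Suc k) = smul (of_nat (Suc k)) (\<theta>b m * \<kappa> ^ k)"
proof (induction k)
  case 0
  show ?case
    using D_\<kappa>[of m 1] by (simp add: D_one)
next
  case (Suc k)
  have "D m (\<kappa> ^ Suc (Suc k)) = \<theta>b m * \<kappa> ^ Suc k + \<kappa> * smul (of_nat (Suc k)) (\<theta>b m * \<kappa> ^ k)"
    by (simp only: power_Suc[of \<kappa> "Suc k"] D_\<kappa> Suc.IH)
  also have "\<kappa> * smul (of_nat (Suc k)) (\<theta>b m * \<kappa> ^ k) = smul (of_nat (Suc k)) (\<theta>b m * \<kappa> ^ Suc k)"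
    by (simp add: \<kappa>_commute_\<theta>b flip: mult.assoc)
  finally show ?case
    by (simp only: of_nat_Suc[of "Suc k"] ext.scale_left_distrib ext.scale_one)
qed

lemma hol_degree_E: "hol_degree 1 (E i j)"
  using hol_degree_mult[OF hol_degree_\<theta> hol_degree_\<theta>b] by (simp add: E_def)

lemma hol_degree_\<kappa>_power: "hol_degree k (\<kappa> ^ k)"
proof -
  have "hol_degree 1 \<kappa>"
    unfolding \<kappa>_def by (intro hol_degree_sum hol_degree_E)
  from hol_degree_power[OF this, of k] show ?thesis
    by simp
qed

text \<open>Contracting \<open>\<kappa>\<^sup>n = 0\<close> successively \<open>n\<close> times would annihilate the product of \<open>n\<close> arbitrary
  antiholomorphic \<open>1\<close>-forms; this is how \<open>\<kappa>\<^sup>n \<noteq> 0\<close> is obtained without determinants.\<close>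
lemma prod_list_\<theta>b_power_eq_0:
  assumes "\<kappa> ^ CARD('n) = 0" "length cs + k = CARD('n)"
  shows "prod_list (map (\<lambda>c. \<Sum>m\<in>UNIV. smul (c m) (\<theta>b m)) cs) * \<kappa> ^ k = 0"
  using assms(2)
proof (induction cs arbitrary: k rule: rev_induct)
  case Nil
  then show ?case using assms(1) by simp
next
  case (snoc c cs)
  define P where "P = prod_list (map (\<lambda>c. \<Sum>m\<in>UNIV. smul (c m) (\<theta>b m)) cs)"
  have DP: "D m (P * x) = (- 1) ^ length cs * (P * D m x)" for m x
    unfolding P_def
  proof (induction cs)
    case (Cons a cs)
    define \<eta> where "\<eta> = (\<Sum>m\<in>UNIV. smul (a m) (\<theta>b m))"
    have D\<eta>: "D m (\<eta> * y) = - (\<eta> * D m y)" for y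
      by (simp add: \<eta>_def sum_distrib_right D_sum D_smul D_\<theta>b sum_negf)
    have "\<eta> * (- 1) ^ k = (- 1) ^ k * \<eta>" for k
      by (metis mult_minus1 mult_minus1_right power_commuting_commutes)
    then have "\<eta> * ((- 1) ^ k * y) = (- 1) ^ k * (\<eta> * y)" for k y
      by (metis mult.assoc)
    then show ?case
      by (simp add: \<eta>_def[symmetric] mult.assoc D\<eta> Cons.IH)
  qed simp
  \<comment> \<open>The induction hypothesis has one form fewer and one more \<kappa>. Contracting
    with \<open>D m\<close> passes \<open>P\<close> up to a sign and turns a factor \<kappa> into
    \<open>\<theta>b m\<close>; a linear combination over \<open>m\<close> restores the removed last
    form.\<close>
  have "P * \<kappa> ^ Suc k = 0"
    unfolding P_def using snoc.IH[of "Suc k"] snoc.prems by (simp del: power_Suc)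
  then have "(- 1) ^ length cs * (P * D m (\<kappa> ^ Suc k)) = 0" for m
    by (metis DP D_zero)
  then have "(- 1) ^ length cs * ((- 1) ^ length cs * (P * D m (\<kappa> ^ Suc k))) = 0" for m
    by simp
  moreover have "(- 1) ^ length cs * (- 1) ^ length cs = (1 :: 'n ext)"
    by (simp flip: power_add mult_2)
  ultimately have "P * D m (\<kappa> ^ Suc k) = 0" for m
    by (metis mult.assoc mult_1)
  then have "smul (of_nat (Suc k)) (P * (\<theta>b m * \<kappa> ^ k)) = 0" for m
    by (simp only: D_\<kappa>_power smul_mult_right)
  then have "P * (\<theta>b m * \<kappa> ^ k) = 0" for m
    using ext.scale_eq_0_iff of_nat_eq_0_iff by blast
  then show ?case
    by (simp add: P_def[symmetric] sum_distrib_left sum_distrib_right mult.assoc)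
qed

text \<open>Each of the next three identities results from applying \<open>D j\<close> to a product of \<open>\<theta> i\<close> with factors
  \<open>E\<close> and a power of \<open>\<kappa>\<close>, which is zero because it contains \<open>n + 1\<close> of the \<open>dz\<close>.\<close>
lemma contract_E_power:
  assumes "CARD('n) = Suc p"
  shows "smul (of_nat (Suc p)) (E i j * \<kappa> ^ p) = smul (if i = j then 1 else 0) (\<kappa> ^ Suc p)"
proof -
  have "\<theta> i * \<kappa> ^ Suc p = 0"
    using assms by (intro hol_degree_gt_eq_0[OF hol_degree_mult[OF hol_degree_\<theta> hol_degree_\<kappa>_power]]) simp
  then have "(if j = i then \<kappa> ^ Suc p else 0) - \<theta> i * D j (\<kappa> ^ Suc p) = 0"
    by (metis D_\<theta> D_zero)
  then show ?thesis
    by (simp add: D_\<kappa>_power E_def mult.assoc del: power_Suc split: if_splits)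
qed

lemma contract_EE_power:
  assumes "CARD('n) = Suc (Suc p)"
  shows "smul (of_nat (Suc p)) (E i j * E k l * \<kappa> ^ p) =
    smul (if i = j then 1 else 0) (E k l * \<kappa> ^ Suc p)
    - smul (if j = k then 1 else 0) (E i l * \<kappa> ^ Suc p)"
proof -
  have "\<theta> i * (E k l * \<kappa> ^ Suc p) = 0"
    using assms
    by (intro hol_degree_gt_eq_0[OF hol_degree_mult[OF hol_degree_\<theta>
            hol_degree_mult[OF hol_degree_E hol_degree_\<kappa>_power]]]) simp
  then have "(if j = i then E k l * \<kappa> ^ Suc p else 0) - \<theta> i * D j (E k l * \<kappa> ^ Suc p) = 0"
    by (metis D_\<theta> D_zero)
  then have "smul (if i = j then 1 else 0) (E k l * \<kappa> ^ Suc p)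
      - smul (if j = k then 1 else 0) (E i l * \<kappa> ^ Suc p)
      - smul (of_nat (Suc p)) (\<theta> i * (E k l * (\<theta>b j * \<kappa> ^ p))) = 0"
    unfolding D_E D_\<kappa>_power
    by (cases "i = j"; cases "j = k")
      (simp_all add: \<theta>_\<theta>b_mult distrib_left diff_diff_eq neg_eq_iff_add_eq_0 del: power_Suc of_nat_Suc)
  \<comment> \<open>The factor \<open>\<theta>b j\<close> left by the contracted \<kappa> moves
    through the even factor \<open>E k l\<close> and completes \<open>\<theta> i\<close> to
    \<open>E i j\<close>.\<close>
  moreover have "\<theta> i * (E k l * (\<theta>b j * \<kappa> ^ p)) = E i j * (E k l * \<kappa> ^ p)"
    by (simp only: E_\<theta>b_left_commute \<theta>_\<theta>b_mult)
  ultimately have "smul (if i = j then 1 else 0) (E k l * \<kappa> ^ Suc p)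
      - smul (if j = k then 1 else 0) (E i l * \<kappa> ^ Suc p)
      = smul (of_nat (Suc p)) (E i j * (E k l * \<kappa> ^ p))"
    by (simp only: right_minus_eq)
  then show ?thesis
    by (simp only: mult.assoc)
qed

lemma contract_EEE_power:
  assumes "CARD('n) = Suc (Suc (Suc p))"
  shows "smul (of_nat (Suc p)) (E i j * E k l * E u v * \<kappa> ^ p) =
    smul (if i = j then 1 else 0) (E k l * E u v * \<kappa> ^ Suc p)
    - smul (if j = k then 1 else 0) (E i l * E u v * \<kappa> ^ Suc p)
    - smul (if j = u then 1 else 0) (E i v * E k l * \<kappa> ^ Suc p)"
proof -
  have "\<theta> i * (E k l * (E u v * \<kappa> ^ Suc p)) = 0"
    using assms
    by (intro hol_degree_gt_eq_0[OF hol_degree_mult[OF hol_degree_\<theta>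
            hol_degree_mult[OF hol_degree_E hol_degree_mult[OF hol_degree_E hol_degree_\<kappa>_power]]]]) simp
  then have "(if j = i then E k l * (E u v * \<kappa> ^ Suc p) else 0)
      - \<theta> i * D j (E k l * (E u v * \<kappa> ^ Suc p)) = 0"
    by (metis D_\<theta> D_zero)
  then have "smul (if i = j then 1 else 0) (E k l * (E u v * \<kappa> ^ Suc p))
      - smul (if j = k then 1 else 0) (E i l * (E u v * \<kappa> ^ Suc p))
      - smul (if j = u then 1 else 0) (\<theta> i * (E k l * (\<theta>b v * \<kappa> ^ Suc p)))
      - smul (of_nat (Suc p)) (\<theta> i * (E k l * (E u v * (\<theta>b j * \<kappa> ^ p)))) = 0"
    unfolding D_E D_\<kappa>_power
    by (cases "i = j"; cases "j = k"; cases "j = u")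
      (simp_all add: \<theta>_\<theta>b_mult distrib_left diff_diff_eq neg_eq_iff_add_eq_0 del: power_Suc of_nat_Suc)
  moreover have "\<theta> i * (E k l * (\<theta>b v * x)) = E i v * (E k l * x)" for x
    by (simp only: E_\<theta>b_left_commute \<theta>_\<theta>b_mult)
  moreover have "\<theta> i * (E k l * (E u v * (\<theta>b j * x))) = E i j * (E k l * (E u v * x))" for x
    by (simp only: E_\<theta>b_left_commute \<theta>_\<theta>b_mult)
  ultimately have "smul (if i = j then 1 else 0) (E k l * (E u v * \<kappa> ^ Suc p))
      - smul (if j = k then 1 else 0) (E i l * (E u v * \<kappa> ^ Suc p))
      - smul (if j = u then 1 else 0) (E i v * (E k l * \<kappa> ^ Suc p))
      = smul (of_nat (Suc p)) (E i j * (E k l * (E u v * \<kappa> ^ p)))"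
    by (simp only: right_minus_eq)
  then show ?thesis
    by (simp only: mult.assoc)
qed

text \<open>Two successive contractions remove one \<open>E\<close> each; the power rule contributes
  the two integers, and the deltas form a 2 x 2 determinant.\<close>

lemma EE_power:
  assumes "CARD('n) = Suc (Suc p)"
  shows "smul (of_nat (Suc (Suc p)) * of_nat (Suc p)) (E i j * E k l * \<kappa> ^ p) =
    smul (\<delta> i j * \<delta> k l - \<delta> j k * \<delta> i l) (\<kappa> ^ CARD('n))"
proof -
  let ?n = "of_nat (Suc (Suc p)) :: complex"
  have "smul (?n * of_nat (Suc p)) (E i j * E k l * \<kappa> ^ p) =
      smul ?n (smul (of_nat (Suc p)) (E i j * E k l * \<kappa> ^ p))"
    by (simp only: ext.scale_scale)
  also have "\<dots> = smul (\<delta> i j) (smul ?n (E k l * \<kappa> ^ Suc p)) - smul (\<delta> j k) (smul ?n (E i l * \<kappa> ^ Suc p))"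
    by (simp only: contract_EE_power[OF assms] ext.scale_right_diff_distrib ext.scale_scale mult.commute)
  also have "\<dots> = smul (\<delta> i j * \<delta> k l - \<delta> j k * \<delta> i l) (\<kappa> ^ CARD('n))"
    by (simp only: contract_E_power[OF assms] ext.scale_left_diff_distrib ext.scale_scale assms)
  finally show ?thesis .
qed

text \<open>One contraction reduces to \<open>EE_power\<close> with \<open>Suc p\<close> in place of
  \<open>p\<close>. The bracket is the 3 x 3 determinant of deltas expanded along the barred index
  \<open>j\<close>.\<close>

lemma EEE_power:
  assumes "CARD('n) = Suc (Suc (Suc p))"
  shows "smul (of_nat (Suc (Suc (Suc p))) * of_nat (Suc (Suc p)) * of_nat (Suc p))
      (E i j * E k l * E u v * \<kappa> ^ p) =
    smul (\<delta> i j * (\<delta> k l * \<delta> u v - \<delta> l u * \<delta> k v)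
        - \<delta> j k * (\<delta> i l * \<delta> u v - \<delta> l u * \<delta> i v)
        - \<delta> j u * (\<delta> i v * \<delta> k l - \<delta> v k * \<delta> i l)) (\<kappa> ^ CARD('n))"
proof -
  let ?n = "of_nat (Suc (Suc (Suc p))) * of_nat (Suc (Suc p)) :: complex"
  have "smul (?n * of_nat (Suc p)) (E i j * E k l * E u v * \<kappa> ^ p) =
      smul ?n (smul (of_nat (Suc p)) (E i j * E k l * E u v * \<kappa> ^ p))"
    by (simp only: ext.scale_scale)
  also have "\<dots> = smul (\<delta> i j) (smul ?n (E k l * E u v * \<kappa> ^ Suc p))
      - smul (\<delta> j k) (smul ?n (E i l * E u v * \<kappa> ^ Suc p))
      - smul (\<delta> j u) (smul ?n (E i v * E k l * \<kappa> ^ Suc p))"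
    unfolding contract_EEE_power[OF assms] ext.scale_right_diff_distrib ext.scale_scale
    by (simp only: mult.commute)
  also have "\<dots> = smul (\<delta> i j * (\<delta> k l * \<delta> u v - \<delta> l u * \<delta> k v)
        - \<delta> j k * (\<delta> i l * \<delta> u v - \<delta> l u * \<delta> i v)
        - \<delta> j u * (\<delta> i v * \<delta> k l - \<delta> v k * \<delta> i l)) (\<kappa> ^ CARD('n))"
    unfolding EE_power[OF assms] ext.scale_scale by (simp only: ext.scale_left_diff_distrib)
  finally show ?thesis .
qed

lemma sum_EE_power:
  assumes "CARD('n) = Suc (Suc p)"
  shows "smul (of_nat (Suc (Suc p)) * of_nat (Suc p))
      ((\<Sum>m\<in>UNIV. \<Sum>q\<in>UNIV. \<Sum>t\<in>UNIV. \<Sum>r\<in>UNIV. smul (B m q t r) (E m q * E t r)) * \<kappa> ^ p) =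
    smul ((\<Sum>m\<in>UNIV. \<Sum>t\<in>UNIV. B m m t t) - (\<Sum>m\<in>UNIV. \<Sum>t\<in>UNIV. B m t t m)) (\<kappa> ^ CARD('n))"
proof -
  have "smul (of_nat (Suc (Suc p)) * of_nat (Suc p))
      ((\<Sum>m\<in>UNIV. \<Sum>q\<in>UNIV. \<Sum>t\<in>UNIV. \<Sum>r\<in>UNIV. smul (B m q t r) (E m q * E t r)) * \<kappa> ^ p) =
    (\<Sum>m\<in>UNIV. \<Sum>q\<in>UNIV. \<Sum>t\<in>UNIV. \<Sum>r\<in>UNIV. smul (B m q t r)
      (smul (of_nat (Suc (Suc p)) * of_nat (Suc p)) (E m q * E t r * \<kappa> ^ p)))"
    by (simp only: sum_distrib_right ext.scale_sum_right smul_mult_left ext.scale_scale mult.commute)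
  also have "\<dots> = smul (\<Sum>m\<in>UNIV. \<Sum>q\<in>UNIV. \<Sum>t\<in>UNIV. \<Sum>r\<in>UNIV.
      B m q t r * (\<delta> m q * \<delta> t r - \<delta> q t * \<delta> m r)) (\<kappa> ^ CARD('n))"
    by (simp only: EE_power[OF assms] ext.scale_sum_left ext.scale_scale)
  finally show ?thesis
    by (simp only: sum_delta2)
qed

lemma sum_EEE_power:
  assumes "CARD('n) = Suc (Suc (Suc p))"
  shows "smul (of_nat (Suc (Suc (Suc p))) * of_nat (Suc (Suc p)) * of_nat (Suc p))
      ((\<Sum>m\<in>UNIV. \<Sum>q\<in>UNIV. \<Sum>t\<in>UNIV. \<Sum>r\<in>UNIV. \<Sum>x\<in>UNIV. \<Sum>y\<in>UNIV.
        smul (A m t r * A' q x y) (E m q * E t r * E x y)) * \<kappa> ^ p) =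
    smul (torsion_pairing A A') (\<kappa> ^ CARD('n))"
proof -
  let ?n = "of_nat (Suc (Suc (Suc p))) * of_nat (Suc (Suc p)) * of_nat (Suc p) :: complex"
  have "smul ?n ((\<Sum>m\<in>UNIV. \<Sum>q\<in>UNIV. \<Sum>t\<in>UNIV. \<Sum>r\<in>UNIV. \<Sum>x\<in>UNIV. \<Sum>y\<in>UNIV.
        smul (A m t r * A' q x y) (E m q * E t r * E x y)) * \<kappa> ^ p) =
    (\<Sum>m\<in>UNIV. \<Sum>q\<in>UNIV. \<Sum>t\<in>UNIV. \<Sum>r\<in>UNIV. \<Sum>x\<in>UNIV. \<Sum>y\<in>UNIV.
        smul (A m t r * A' q x y) (smul ?n (E m q * E t r * E x y * \<kappa> ^ p)))"
    unfolding sum_distrib_right ext.scale_sum_right smul_mult_left ext.scale_scale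
    by (simp only: mult.commute)
  also have "\<dots> = smul (\<Sum>m\<in>UNIV. \<Sum>q\<in>UNIV. \<Sum>t\<in>UNIV. \<Sum>r\<in>UNIV. \<Sum>x\<in>UNIV. \<Sum>y\<in>UNIV.
      A m t r * A' q x y * (\<delta> m q * (\<delta> t r * \<delta> x y - \<delta> r x * \<delta> t y)
        - \<delta> q t * (\<delta> m r * \<delta> x y - \<delta> r x * \<delta> m y)
        - \<delta> q x * (\<delta> m y * \<delta> t r - \<delta> y t * \<delta> m r))) (\<kappa> ^ CARD('n))"
    by (simp only: EEE_power[OF assms] ext.scale_sum_left ext.scale_scale)
  finally show ?thesis
    by (simp only: sum_delta3)
qed

end

section \<open>Unitary frames\<close>

lemma sum_swap_pairs:
  "(\<Sum>k\<in>K. \<Sum>l\<in>L. \<Sum>t\<in>T. \<Sum>r\<in>R. f k l t r) =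
    (\<Sum>t\<in>T. \<Sum>r\<in>R. \<Sum>k\<in>K. \<Sum>l\<in>L. (f k l t r :: 'b::comm_monoid_add))"
proof -
  have "(\<Sum>k\<in>K. \<Sum>l\<in>L. \<Sum>t\<in>T. \<Sum>r\<in>R. f k l t r) =
      (\<Sum>(k, l)\<in>K \<times> L. \<Sum>(t, r)\<in>T \<times> R. f k l t r)"
    by (simp flip: sum.cartesian_product)
  also have "\<dots> = (\<Sum>(t, r)\<in>T \<times> R. \<Sum>(k, l)\<in>K \<times> L. f k l t r)"
    unfolding case_prod_unfold by (rule sum.swap)
  finally show ?thesis
    by (simp flip: sum.cartesian_product)
qed

text \<open>The columns of \<open>Q\<close> are the frame vectors, the rows of \<open>W\<close> the dual coframe.\<close>
locale frame =
  fixes W Q :: "'n::{finite,linorder} \<Rightarrow> 'n \<Rightarrow> complex"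
  assumes W_Q: "(\<Sum>k\<in>UNIV. W m k * Q k t) = \<delta> m t"
    and Q_W: "(\<Sum>m\<in>UNIV. Q i m * W m k) = \<delta> i k"
begin

definition \<theta> :: "'n \<Rightarrow> 'n ext" where
  "\<theta> m = (\<Sum>k\<in>UNIV. smul (W m k) (dzE k))"

definition \<theta>b :: "'n \<Rightarrow> 'n ext" where
  "\<theta>b m = (\<Sum>k\<in>UNIV. smul (cnj (W m k)) (dzbarE k))"

definition D :: "'n \<Rightarrow> 'n ext \<Rightarrow> 'n ext" where
  "D m x = (\<Sum>k\<in>UNIV. smul (Q k m) (contr k x))"

text \<open>The inverse of the metric for which the frame is unitary; it is identified with
  \<open>hinv (g z)\<close> once the frame is adapted to \<open>g z\<close>.\<close>

definition H :: "'n \<Rightarrow> 'n \<Rightarrow> complex" where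
  "H i j = (\<Sum>m\<in>UNIV. Q i m * cnj (Q j m))"

lemma sum_mult_sum_anticommute:
  assumes "\<And>i k. f i * g k = - (g k * (f i :: 'n ext))"
  shows "(\<Sum>i\<in>UNIV. smul (c i) (f i)) * (\<Sum>k\<in>UNIV. smul (d k) (g k)) =
    - ((\<Sum>k\<in>UNIV. smul (d k) (g k)) * (\<Sum>i\<in>UNIV. smul (c i) (f i)))"
proof -
  have "(\<Sum>i\<in>UNIV. smul (c i) (f i)) * (\<Sum>k\<in>UNIV. smul (d k) (g k)) =
      (\<Sum>k\<in>UNIV. \<Sum>i\<in>UNIV. smul (c i * d k) (f i * g k))"
    by (simp add: sum_distrib_left sum_distrib_right ext.scale_sum_right mult.commute)
  also have "\<dots> = (\<Sum>i\<in>UNIV. \<Sum>k\<in>UNIV. - smul (c i * d k) (g k * f i))"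
    by (subst sum.swap) (simp add: assms)
  also have "\<dots> = - ((\<Sum>k\<in>UNIV. smul (d k) (g k)) * (\<Sum>i\<in>UNIV. smul (c i) (f i)))"
    by (simp add: sum_distrib_left sum_distrib_right ext.scale_sum_right sum_negf mult.commute)
  finally show ?thesis .
qed

sublocale coframe \<theta> \<theta>b D
proof
  fix i k m :: 'n and x y :: "'n ext" and c
  show "\<theta>b i * \<theta>b k = - (\<theta>b k * \<theta>b i)"
    unfolding \<theta>b_def by (intro sum_mult_sum_anticommute dzbarE_anticommute)
  show "\<theta> i * \<theta>b k = - (\<theta>b k * \<theta> i)"
    unfolding \<theta>_def \<theta>b_def by (intro sum_mult_sum_anticommute dzE_dzbarE_anticommute)
  show "hol_degree 1 (\<theta> i)"
    unfolding \<theta>_def by (intro hol_degree_sum hol_degree_smul hol_degree_dzE)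
  show "hol_degree 0 (\<theta>b i)"
    unfolding \<theta>b_def by (intro hol_degree_sum hol_degree_smul hol_degree_dzbarE)
  show "D m (x + y) = D m x + D m y"
    by (simp add: D_def contr_add ext.scale_right_distrib sum.distrib)
  show "D m (smul c x) = smul c (D m x)"
    by (simp add: D_def contr_smul ext.scale_sum_right mult.commute)
  show "D m 1 = 0"
    by (simp add: D_def contr_one)
  have contr_sum: "contr k (\<Sum>i\<in>UNIV. f i) = (\<Sum>i\<in>UNIV. contr k (f i))" for k and f :: "'n \<Rightarrow> 'n ext"
    by (rule ext_eqI) (simp add: coeff_contr coeff_sum sum_distrib_left)
  \<comment> \<open>\<open>D m\<close> is contraction with the m-th column of \<open>Q\<close>. Each
    \<open>contr k\<close> contributes its diagonal term, and \<open>W_Q\<close> sums these to the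
    delta of the dual coframe.\<close>
  have "D m (\<theta> i * x) = (\<Sum>k\<in>UNIV. \<Sum>l\<in>UNIV. smul (Q k m * W i l) (if k = l then x else 0))
      - (\<Sum>k\<in>UNIV. \<Sum>l\<in>UNIV. smul (Q k m * W i l) (dzE l * contr k x))"
    by (simp add: D_def \<theta>_def sum_distrib_right contr_sum contr_smul contr_dzE_mult
        ext.scale_right_diff_distrib ext.scale_sum_right sum_subtractf)
  also have "(\<Sum>k\<in>UNIV. \<Sum>l\<in>UNIV. smul (Q k m * W i l) (if k = l then x else 0)) =
      smul (\<Sum>k\<in>UNIV. W i k * Q k m) x"
    by (simp add: ext.scale_sum_left if_distrib[of "smul c" for c] sum.delta mult.commute cong: if_cong)
  also have "\<dots> = (if m = i then x else 0)"
    by (simp add: W_Q)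
  also have "(\<Sum>k\<in>UNIV. \<Sum>l\<in>UNIV. smul (Q k m * W i l) (dzE l * contr k x)) = \<theta> i * D m x"
    unfolding D_def \<theta>_def
    by (simp add: sum_distrib_right sum_distrib_left ext.scale_sum_right mult.commute)
  finally show "D m (\<theta> i * x) = (if m = i then x else 0) - \<theta> i * D m x" .
  have "D m (\<theta>b i * x) = - (\<Sum>k\<in>UNIV. \<Sum>l\<in>UNIV. smul (Q k m * cnj (W i l)) (dzbarE l * contr k x))"
    by (simp add: D_def \<theta>b_def sum_distrib_right contr_sum contr_smul contr_dzbarE_mult
        ext.scale_sum_right sum_negf)
  also have "(\<Sum>k\<in>UNIV. \<Sum>l\<in>UNIV. smul (Q k m * cnj (W i l)) (dzbarE l * contr k x)) = \<theta>b i * D m x"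
    unfolding D_def \<theta>b_def
    by (simp add: sum_distrib_right sum_distrib_left ext.scale_sum_right mult.commute)
  finally show "D m (\<theta>b i * x) = - (\<theta>b i * D m x)" .
qed

lemma dzE_eq: "dzE i = (\<Sum>m\<in>UNIV. smul (Q i m) (\<theta> m))"
proof -
  have "(\<Sum>m\<in>UNIV. smul (Q i m) (\<theta> m)) = (\<Sum>k\<in>UNIV. smul (\<Sum>m\<in>UNIV. Q i m * W m k) (dzE k))"
    unfolding \<theta>_def ext.scale_sum_right ext.scale_sum_left ext.scale_scale by (rule sum.swap)
  then show ?thesis
    by (simp add: Q_W if_distrib[of "\<lambda>c. smul c x" for x] sum.delta cong: if_cong)
qed

lemma dzbarE_eq: "dzbarE i = (\<Sum>m\<in>UNIV. smul (cnj (Q i m)) (\<theta>b m))"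
proof -
  have "(\<Sum>m\<in>UNIV. smul (cnj (Q i m)) (\<theta>b m)) =
      (\<Sum>k\<in>UNIV. smul (cnj (\<Sum>m\<in>UNIV. Q i m * W m k)) (dzbarE k))"
    unfolding \<theta>b_def ext.scale_sum_right ext.scale_sum_left ext.scale_scale cnj_sum complex_cnj_mult
    by (rule sum.swap)
  then show ?thesis
    by (simp add: Q_W if_distrib[of "\<lambda>c. smul c x" for x] if_distrib[of cnj] sum.delta cong: if_cong)
qed

text \<open>Every dzbar is a combination of the \<open>\<theta>b m\<close>. If the power vanished,
  \<open>prod_list_\<theta>b_power_eq_0\<close> with exponent 0 would annihilate the product of all
  the dzbar.\<close>

lemma \<kappa>_power_nonzero: "\<kappa> ^ CARD('n) \<noteq> 0"
proof
  assume 0: "\<kappa> ^ CARD('n) = 0"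
  define js where "js = sorted_list_of_set (UNIV :: 'n set)"
  have js: "distinct js" "set js = UNIV" "length js = CARD('n)"
    by (simp_all add: js_def)
  define cs where "cs = map (\<lambda>j m. cnj (Q j m)) js"
  have "prod_list (map (\<lambda>c. \<Sum>m\<in>UNIV. smul (c m) (\<theta>b m)) cs) * \<kappa> ^ 0 = 0"
    using 0 by (rule prod_list_\<theta>b_power_eq_0) (simp add: cs_def js)
  then have "prod_list (map dzbarE js) = 0"
    by (simp add: cs_def o_def flip: dzbarE_eq)
  then show False
    using prod_list_dzbarE_nonzero[OF js(1)] by simp
qed

text \<open>Unbarred indices are contracted with \<open>Q\<close>, barred ones with its conjugate.\<close>
definition frame_coeff :: "('n \<Rightarrow> 'n \<Rightarrow> complex) \<Rightarrow> 'n \<Rightarrow> 'n \<Rightarrow> complex" where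
  "frame_coeff b t r = (\<Sum>k\<in>UNIV. Q k t * (\<Sum>l\<in>UNIV. cnj (Q l r) * b k l))"

lemma sum_dz_dzbar:
  "(\<Sum>k\<in>UNIV. \<Sum>l\<in>UNIV. smul (b k l) (dzE k * dzbarE l)) =
    (\<Sum>t\<in>UNIV. \<Sum>r\<in>UNIV. smul (frame_coeff b t r) (E t r))"
proof -
  have "(\<Sum>k\<in>UNIV. \<Sum>l\<in>UNIV. smul (b k l) (dzE k * dzbarE l)) =
    (\<Sum>k\<in>UNIV. \<Sum>l\<in>UNIV. \<Sum>t\<in>UNIV. \<Sum>r\<in>UNIV. smul (Q k t * (cnj (Q l r) * b k l)) (E t r))"
    by (simp add: dzE_eq dzbarE_eq sum_distrib_left sum_distrib_right ext.scale_sum_right E_def mult_ac)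
      (intro sum.cong refl sum.swap)
  also have "\<dots> = (\<Sum>t\<in>UNIV. \<Sum>r\<in>UNIV. \<Sum>k\<in>UNIV. \<Sum>l\<in>UNIV. smul (Q k t * (cnj (Q l r) * b k l)) (E t r))"
    by (rule sum_swap_pairs)
  also have "\<dots> = (\<Sum>t\<in>UNIV. \<Sum>r\<in>UNIV. smul (frame_coeff b t r) (E t r))"
    by (simp add: frame_coeff_def ext.scale_sum_left sum_distrib_left)
  finally show ?thesis .
qed

end

lemma sum_reverse3:
  "(\<Sum>j\<in>J. \<Sum>k\<in>K. \<Sum>l\<in>L. f j k l) = (\<Sum>l\<in>L. \<Sum>k\<in>K. \<Sum>j\<in>J. (f j k l :: 'b::comm_monoid_add))"
proof -
  have "(\<Sum>j\<in>J. \<Sum>k\<in>K. \<Sum>l\<in>L. f j k l) = (\<Sum>j\<in>J. \<Sum>l\<in>L. \<Sum>k\<in>K. f j k l)"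
    by (intro sum.cong refl sum.swap)
  also have "\<dots> = (\<Sum>l\<in>L. \<Sum>j\<in>J. \<Sum>k\<in>K. f j k l)"
    by (rule sum.swap)
  also have "\<dots> = (\<Sum>l\<in>L. \<Sum>k\<in>K. \<Sum>j\<in>J. f j k l)"
    by (intro sum.cong refl sum.swap)
  finally show ?thesis .
qed

lemma sum_swap_pair_single:
  "(\<Sum>r\<in>R. \<Sum>k\<in>K. \<Sum>l\<in>L. f r k l) = (\<Sum>k\<in>K. \<Sum>l\<in>L. \<Sum>r\<in>R. (f r k l :: 'b::comm_monoid_add))"
proof -
  have "(\<Sum>r\<in>R. \<Sum>k\<in>K. \<Sum>l\<in>L. f r k l) = (\<Sum>k\<in>K. \<Sum>r\<in>R. \<Sum>l\<in>L. f r k l)"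
    by (rule sum.swap)
  also have "\<dots> = (\<Sum>k\<in>K. \<Sum>l\<in>L. \<Sum>r\<in>R. f r k l)"
    by (intro sum.cong refl sum.swap)
  finally show ?thesis .
qed

section \<open>Traces in the frame as contractions with the inverse metric\<close>

context frame
begin

lemma sum_frame:
  "(\<Sum>m\<in>UNIV. (\<Sum>i\<in>UNIV. Q i m * \<alpha> i) * (\<Sum>j\<in>UNIV. cnj (Q j m) * \<beta> j)) =
    (\<Sum>i\<in>UNIV. \<Sum>j\<in>UNIV. H i j * (\<alpha> i * \<beta> j))"
proof -
  have "(\<Sum>m\<in>UNIV. (\<Sum>i\<in>UNIV. Q i m * \<alpha> i) * (\<Sum>j\<in>UNIV. cnj (Q j m) * \<beta> j)) =
      (\<Sum>m\<in>UNIV. \<Sum>i\<in>UNIV. \<Sum>j\<in>UNIV. Q i m * cnj (Q j m) * (\<alpha> i * \<beta> j))"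
    by (simp add: sum_product mult_ac)
  also have "\<dots> = (\<Sum>i\<in>UNIV. \<Sum>j\<in>UNIV. \<Sum>m\<in>UNIV. Q i m * cnj (Q j m) * (\<alpha> i * \<beta> j))"
    by (rule sum_swap_pair_single)
  finally show ?thesis
    by (simp add: H_def sum_distrib_right)
qed

lemma sum_frame_coeff_diag: "(\<Sum>t\<in>UNIV. frame_coeff b t t) = (\<Sum>k\<in>UNIV. \<Sum>l\<in>UNIV. H k l * b k l)"
proof -
  have "(\<Sum>t\<in>UNIV. frame_coeff b t t) = (\<Sum>t\<in>UNIV. \<Sum>k\<in>UNIV. \<Sum>l\<in>UNIV. Q k t * cnj (Q l t) * b k l)"
    by (simp add: frame_coeff_def sum_distrib_left mult_ac)
  also have "\<dots> = (\<Sum>k\<in>UNIV. \<Sum>l\<in>UNIV. \<Sum>t\<in>UNIV. Q k t * cnj (Q l t) * b k l)"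
    by (rule sum_swap_pair_single)
  finally show ?thesis
    by (simp add: H_def sum_distrib_right)
qed

lemma sum_frame_coeff2_diag:
  "(\<Sum>m\<in>UNIV. \<Sum>t\<in>UNIV. frame_coeff (\<lambda>i j. frame_coeff (b i j) t t) m m) =
    (\<Sum>i\<in>UNIV. \<Sum>j\<in>UNIV. H i j * (\<Sum>k\<in>UNIV. \<Sum>l\<in>UNIV. H k l * b i j k l))"
proof -
  have "(\<Sum>m\<in>UNIV. \<Sum>t\<in>UNIV. frame_coeff (\<lambda>i j. frame_coeff (b i j) t t) m m) =
      (\<Sum>t\<in>UNIV. \<Sum>i\<in>UNIV. \<Sum>j\<in>UNIV. H i j * frame_coeff (b i j) t t)"
    by (subst sum.swap) (simp only: sum_frame_coeff_diag)
  also have "\<dots> = (\<Sum>i\<in>UNIV. \<Sum>j\<in>UNIV. \<Sum>t\<in>UNIV. H i j * frame_coeff (b i j) t t)"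
    by (rule sum_swap_pair_single)
  finally show ?thesis
    by (simp only: sum_distrib_left[symmetric] sum_frame_coeff_diag)
qed

text \<open>Interchanging the two barred slots of \<open>b\<close> reduces the crossed trace, which
  belongs to the second scalar curvature, to the diagonal one.\<close>

lemma sum_frame_coeff2_cross:
  "(\<Sum>m\<in>UNIV. \<Sum>t\<in>UNIV. frame_coeff (\<lambda>i j. frame_coeff (b i j) t m) m t) =
    (\<Sum>i\<in>UNIV. \<Sum>l\<in>UNIV. H i l * (\<Sum>k\<in>UNIV. \<Sum>j\<in>UNIV. H k j * b i j k l))"
proof -
  have "frame_coeff (\<lambda>i j. frame_coeff (b i j) t m) m t = frame_coeff (\<lambda>i l. frame_coeff (\<lambda>k j. b i j k l) t t) m m" for m t
  proof -
    have "frame_coeff (\<lambda>i j. frame_coeff (b i j) t m) m t = (\<Sum>i\<in>UNIV. Q i m * (\<Sum>j\<in>UNIV. \<Sum>k\<in>UNIV. \<Sum>l\<in>UNIV.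
        cnj (Q j t) * (Q k t * (cnj (Q l m) * b i j k l))))"
      by (simp add: frame_coeff_def sum_distrib_left)
    also have "\<dots> = (\<Sum>i\<in>UNIV. Q i m * (\<Sum>l\<in>UNIV. \<Sum>k\<in>UNIV. \<Sum>j\<in>UNIV.
        cnj (Q l m) * (Q k t * (cnj (Q j t) * b i j k l))))"
      by (subst sum_reverse3) (simp add: mult_ac)
    also have "\<dots> = frame_coeff (\<lambda>i l. frame_coeff (\<lambda>k j. b i j k l) t t) m m"
      by (simp add: frame_coeff_def sum_distrib_left)
    finally show ?thesis .
  qed
  then show ?thesis
    by (simp only: sum_frame_coeff2_diag)
qed

text \<open>Frame components of the derivatives of a (1,1)-form; the derivative index is unbarred
  here and barred in \<open>frame_coeff_antihol\<close>, hence the conjugate of \<open>Q\<close>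
  there.\<close>

definition frame_coeff_hol :: "('n \<Rightarrow> 'n \<Rightarrow> 'n \<Rightarrow> complex) \<Rightarrow> 'n \<Rightarrow> 'n \<Rightarrow> 'n \<Rightarrow> complex" where
  "frame_coeff_hol a m t r = (\<Sum>i\<in>UNIV. Q i m * frame_coeff (a i) t r)"

definition frame_coeff_antihol :: "('n \<Rightarrow> 'n \<Rightarrow> 'n \<Rightarrow> complex) \<Rightarrow> 'n \<Rightarrow> 'n \<Rightarrow> 'n \<Rightarrow> complex" where
  "frame_coeff_antihol a q x y = (\<Sum>j\<in>UNIV. cnj (Q j q) * frame_coeff (a j) x y)"

text \<open>Each of the three sums over a frame index pairs a \<open>Q\<close> with a conjugate
  \<open>Q\<close> and becomes one factor \<open>H\<close>. The right side is the quadratic part of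
  \<open>scalar_curv\<close>; the crossed version below is that of
  \<open>scalar_curv_hat\<close>.\<close>

lemma sum_frame_coeff3_diag:
  "(\<Sum>m\<in>UNIV. \<Sum>t\<in>UNIV. \<Sum>r\<in>UNIV. frame_coeff_hol a m t r * frame_coeff_antihol a' m r t) =
    (\<Sum>i\<in>UNIV. \<Sum>j\<in>UNIV. H i j * (\<Sum>k\<in>UNIV. \<Sum>l\<in>UNIV. H k l *
      (\<Sum>p\<in>UNIV. \<Sum>q\<in>UNIV. H p q * (a i k q * a' j p l))))"
proof -
  have inner: "(\<Sum>t\<in>UNIV. \<Sum>r\<in>UNIV. frame_coeff c t r * frame_coeff c' r t) =
      (\<Sum>k\<in>UNIV. \<Sum>l\<in>UNIV. H k l * (\<Sum>p\<in>UNIV. \<Sum>q\<in>UNIV. H p q * (c k q * c' p l)))" for c c'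
  proof -
    have "frame_coeff c' r t = (\<Sum>l\<in>UNIV. cnj (Q l t) * (\<Sum>p\<in>UNIV. Q p r * c' p l))" for r t
      unfolding frame_coeff_def sum_distrib_left by (subst sum.swap) (simp add: mult_ac)
    then have "(\<Sum>t\<in>UNIV. \<Sum>r\<in>UNIV. frame_coeff c t r * frame_coeff c' r t) = (\<Sum>r\<in>UNIV. \<Sum>k\<in>UNIV. \<Sum>l\<in>UNIV.
        H k l * ((\<Sum>q\<in>UNIV. cnj (Q q r) * c k q) * (\<Sum>p\<in>UNIV. Q p r * c' p l)))"
      by (subst sum.swap) (simp only: frame_coeff_def sum_frame)
    also have "\<dots> = (\<Sum>k\<in>UNIV. \<Sum>l\<in>UNIV. \<Sum>r\<in>UNIV.
        H k l * ((\<Sum>q\<in>UNIV. cnj (Q q r) * c k q) * (\<Sum>p\<in>UNIV. Q p r * c' p l)))"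
      by (rule sum_swap_pair_single)
    also have "\<dots> = (\<Sum>k\<in>UNIV. \<Sum>l\<in>UNIV. H k l * (\<Sum>r\<in>UNIV.
        (\<Sum>p\<in>UNIV. Q p r * c' p l) * (\<Sum>q\<in>UNIV. cnj (Q q r) * c k q)))"
      unfolding sum_distrib_left[symmetric] by (simp only: mult.commute)
    finally show ?thesis
      unfolding sum_frame by (simp only: mult.commute)
  qed
  have "(\<Sum>m\<in>UNIV. \<Sum>t\<in>UNIV. \<Sum>r\<in>UNIV. frame_coeff_hol a m t r * frame_coeff_antihol a' m r t) =
      (\<Sum>t\<in>UNIV. \<Sum>r\<in>UNIV. \<Sum>m\<in>UNIV. frame_coeff_hol a m t r * frame_coeff_antihol a' m r t)"
    by (rule sum_swap_pair_single)
  also have "\<dots> = (\<Sum>t\<in>UNIV. \<Sum>r\<in>UNIV. \<Sum>i\<in>UNIV. \<Sum>j\<in>UNIV. H i j * (frame_coeff (a i) t r * frame_coeff (a' j) r t))"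
    by (simp only: frame_coeff_hol_def frame_coeff_antihol_def sum_frame)
  also have "\<dots> = (\<Sum>i\<in>UNIV. \<Sum>j\<in>UNIV. \<Sum>t\<in>UNIV. \<Sum>r\<in>UNIV. H i j * (frame_coeff (a i) t r * frame_coeff (a' j) r t))"
    by (rule sum_swap_pairs)
  finally show ?thesis
    by (simp only: sum_distrib_left[symmetric] inner)
qed

lemma sum_frame_coeff3_cross:
  "(\<Sum>m\<in>UNIV. \<Sum>t\<in>UNIV. \<Sum>r\<in>UNIV. frame_coeff_hol a m t r * frame_coeff_antihol a' t r m) =
    (\<Sum>i\<in>UNIV. \<Sum>l\<in>UNIV. H i l * (\<Sum>k\<in>UNIV. \<Sum>j\<in>UNIV. H k j *
      (\<Sum>p\<in>UNIV. \<Sum>q\<in>UNIV. H p q * (a i k q * a' j p l))))"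
proof -
  have "frame_coeff_antihol a' t r m = frame_coeff_antihol (\<lambda>l p j. a' j p l) m r t" for t r m
  proof -
    have "frame_coeff_antihol a' t r m = (\<Sum>j\<in>UNIV. \<Sum>p\<in>UNIV. \<Sum>l\<in>UNIV.
        cnj (Q j t) * (Q p r * (cnj (Q l m) * a' j p l)))"
      by (simp add: frame_coeff_antihol_def frame_coeff_def sum_distrib_left)
    also have "\<dots> = (\<Sum>l\<in>UNIV. \<Sum>p\<in>UNIV. \<Sum>j\<in>UNIV.
        cnj (Q l m) * (Q p r * (cnj (Q j t) * a' j p l)))"
      by (subst sum_reverse3) (simp add: mult_ac)
    finally show ?thesis
      by (simp add: frame_coeff_antihol_def frame_coeff_def sum_distrib_left)
  qed
  then show ?thesis
    by (simp only: sum_frame_coeff3_diag)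
qed

lemma frame_coeff_antihol_cnj: "frame_coeff_antihol (\<lambda>j k l. cnj (a j l k)) q x y = cnj (frame_coeff_hol a q y x)"
proof -
  have "frame_coeff (\<lambda>k l. cnj (c l k)) x y = cnj (frame_coeff c y x)" for c
    unfolding frame_coeff_def sum_distrib_left by (subst sum.swap) (simp add: mult_ac)
  then show ?thesis
    by (simp add: frame_coeff_antihol_def frame_coeff_hol_def)
qed

lemma second_order_sum:
  "(\<Sum>i\<in>UNIV. \<Sum>j\<in>UNIV. dzE i * dzbarE j * (\<Sum>k\<in>UNIV. \<Sum>l\<in>UNIV. smul (b i j k l) (dzE k * dzbarE l))) =
    (\<Sum>m\<in>UNIV. \<Sum>q\<in>UNIV. \<Sum>t\<in>UNIV. \<Sum>r\<in>UNIV.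
      smul (frame_coeff (\<lambda>i j. frame_coeff (b i j) t r) m q) (E m q * E t r))"
proof -
  have "(\<Sum>i\<in>UNIV. \<Sum>j\<in>UNIV. dzE i * dzbarE j * (\<Sum>k\<in>UNIV. \<Sum>l\<in>UNIV. smul (b i j k l) (dzE k * dzbarE l))) =
      (\<Sum>i\<in>UNIV. \<Sum>j\<in>UNIV. \<Sum>t\<in>UNIV. \<Sum>r\<in>UNIV. smul (frame_coeff (b i j) t r) (dzE i * dzbarE j * E t r))"
    unfolding sum_dz_dzbar by (simp only: sum_distrib_left smul_mult_right)
  also have "\<dots> = (\<Sum>t\<in>UNIV. \<Sum>r\<in>UNIV. (\<Sum>i\<in>UNIV. \<Sum>j\<in>UNIV. smul (frame_coeff (b i j) t r) (dzE i * dzbarE j)) * E t r)"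
    by (subst sum_swap_pairs) (simp only: sum_distrib_right smul_mult_left)
  also have "\<dots> = (\<Sum>t\<in>UNIV. \<Sum>r\<in>UNIV. \<Sum>m\<in>UNIV. \<Sum>q\<in>UNIV.
      smul (frame_coeff (\<lambda>i j. frame_coeff (b i j) t r) m q) (E m q * E t r))"
    unfolding sum_dz_dzbar by (simp only: sum_distrib_right smul_mult_left)
  finally show ?thesis
    by (subst sum_swap_pairs)
qed

lemma frame_coeff_product: "frame_coeff (\<lambda>i j. \<alpha> i * \<beta> j) m q = (\<Sum>i\<in>UNIV. Q i m * \<alpha> i) * (\<Sum>j\<in>UNIV. cnj (Q j q) * \<beta> j)"
  unfolding frame_coeff_def sum_distrib_right by (simp add: sum_distrib_left mult_ac)

lemma first_order_sum:
  "(\<Sum>i\<in>UNIV. \<Sum>j\<in>UNIV. dzE i * dzbarE j *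
      ((\<Sum>k\<in>UNIV. \<Sum>l\<in>UNIV. smul (a i k l) (dzE k * dzbarE l)) *
       (\<Sum>k\<in>UNIV. \<Sum>l\<in>UNIV. smul (a' j k l) (dzE k * dzbarE l)))) =
    (\<Sum>m\<in>UNIV. \<Sum>q\<in>UNIV. \<Sum>t\<in>UNIV. \<Sum>r\<in>UNIV. \<Sum>x\<in>UNIV. \<Sum>y\<in>UNIV.
      smul (frame_coeff_hol a m t r * frame_coeff_antihol a' q x y) (E m q * E t r * E x y))"
proof -
  have "(\<Sum>i\<in>UNIV. \<Sum>j\<in>UNIV. dzE i * dzbarE j *
      ((\<Sum>k\<in>UNIV. \<Sum>l\<in>UNIV. smul (a i k l) (dzE k * dzbarE l)) *
       (\<Sum>k\<in>UNIV. \<Sum>l\<in>UNIV. smul (a' j k l) (dzE k * dzbarE l)))) =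
      (\<Sum>i\<in>UNIV. \<Sum>j\<in>UNIV. \<Sum>x\<in>UNIV. \<Sum>y\<in>UNIV. \<Sum>t\<in>UNIV. \<Sum>r\<in>UNIV.
        smul (frame_coeff (a i) t r * frame_coeff (a' j) x y) (dzE i * dzbarE j * (E t r * E x y)))"
    unfolding sum_dz_dzbar sum_distrib_left sum_distrib_right
    by (simp only: sum_distrib_left sum_distrib_right smul_mult_right smul_mult_left ext.scale_scale mult.assoc mult.commute[of "frame_coeff c t r" "frame_coeff c' x y" for c c' t r x y])
  also have "\<dots> = (\<Sum>i\<in>UNIV. \<Sum>j\<in>UNIV. \<Sum>t\<in>UNIV. \<Sum>r\<in>UNIV. \<Sum>x\<in>UNIV. \<Sum>y\<in>UNIV.
      smul (frame_coeff (a i) t r * frame_coeff (a' j) x y) (dzE i * dzbarE j * (E t r * E x y)))"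
    by (intro sum.cong refl sum_swap_pairs)
  also have "\<dots> = (\<Sum>t\<in>UNIV. \<Sum>r\<in>UNIV. \<Sum>i\<in>UNIV. \<Sum>j\<in>UNIV. \<Sum>x\<in>UNIV. \<Sum>y\<in>UNIV.
      smul (frame_coeff (a i) t r * frame_coeff (a' j) x y) (dzE i * dzbarE j * (E t r * E x y)))"
    by (rule sum_swap_pairs)
  also have "\<dots> = (\<Sum>t\<in>UNIV. \<Sum>r\<in>UNIV. \<Sum>x\<in>UNIV. \<Sum>y\<in>UNIV. \<Sum>i\<in>UNIV. \<Sum>j\<in>UNIV.
      smul (frame_coeff (a i) t r * frame_coeff (a' j) x y) (dzE i * dzbarE j * (E t r * E x y)))"
    by (intro sum.cong refl sum_swap_pairs)
  also have "\<dots> = (\<Sum>t\<in>UNIV. \<Sum>r\<in>UNIV. \<Sum>x\<in>UNIV. \<Sum>y\<in>UNIV.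
      (\<Sum>i\<in>UNIV. \<Sum>j\<in>UNIV. smul (frame_coeff (a i) t r * frame_coeff (a' j) x y) (dzE i * dzbarE j)) * (E t r * E x y))"
    by (simp only: sum_distrib_right smul_mult_left)
  also have "\<dots> = (\<Sum>t\<in>UNIV. \<Sum>r\<in>UNIV. \<Sum>x\<in>UNIV. \<Sum>y\<in>UNIV. \<Sum>m\<in>UNIV. \<Sum>q\<in>UNIV.
      smul (frame_coeff_hol a m t r * frame_coeff_antihol a' q x y) (E m q * E t r * E x y))"
    unfolding sum_dz_dzbar frame_coeff_product frame_coeff_hol_def[symmetric] frame_coeff_antihol_def[symmetric]
    by (simp only: sum_distrib_right smul_mult_left mult.assoc)
  also have "\<dots> = (\<Sum>t\<in>UNIV. \<Sum>r\<in>UNIV. \<Sum>m\<in>UNIV. \<Sum>q\<in>UNIV. \<Sum>x\<in>UNIV. \<Sum>y\<in>UNIV.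
      smul (frame_coeff_hol a m t r * frame_coeff_antihol a' q x y) (E m q * E t r * E x y))"
    by (intro sum.cong refl sum_swap_pairs)
  finally show ?thesis
    by (subst sum_swap_pairs)
qed

text \<open>Multiplying by n (n - 1) (n - 2) with n = p + 3 evaluates both summands as multiples of
  the nonzero form \<open>\<kappa> ^ CARD('n)\<close>. The second order summand absorbs only n (n -
  1), so n - 2 = \<open>Suc p\<close> stays in front of it.\<close>

lemma trace_identity:
  assumes n: "CARD('n) = Suc (Suc (Suc p))"
    and eq: "(\<Sum>i\<in>UNIV. \<Sum>j\<in>UNIV. dzE i * dzbarE j *
        (\<Sum>k\<in>UNIV. \<Sum>l\<in>UNIV. smul (b i j k l) (dzE k * dzbarE l))) * \<kappa> ^ Suc p
      + smul c ((\<Sum>i\<in>UNIV. \<Sum>j\<in>UNIV. dzE i * dzbarE j *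
        ((\<Sum>k\<in>UNIV. \<Sum>l\<in>UNIV. smul (a i k l) (dzE k * dzbarE l)) *
         (\<Sum>k\<in>UNIV. \<Sum>l\<in>UNIV. smul (a' j k l) (dzE k * dzbarE l)))) * \<kappa> ^ p) = 0"
  shows "of_nat (Suc p) *
      ((\<Sum>i\<in>UNIV. \<Sum>j\<in>UNIV. H i j * (\<Sum>k\<in>UNIV. \<Sum>l\<in>UNIV. H k l * b i j k l))
       - (\<Sum>i\<in>UNIV. \<Sum>l\<in>UNIV. H i l * (\<Sum>k\<in>UNIV. \<Sum>j\<in>UNIV. H k j * b i j k l)))
      + c * torsion_pairing (frame_coeff_hol a) (frame_coeff_antihol a') = 0"
proof -
  let ?n = "of_nat (Suc (Suc (Suc p))) * of_nat (Suc (Suc p)) :: complex"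
  let ?X = "(\<Sum>m\<in>UNIV. \<Sum>q\<in>UNIV. \<Sum>t\<in>UNIV. \<Sum>r\<in>UNIV.
      smul (frame_coeff (\<lambda>i j. frame_coeff (b i j) t r) m q) (E m q * E t r)) * \<kappa> ^ Suc p"
  let ?Y = "(\<Sum>m\<in>UNIV. \<Sum>q\<in>UNIV. \<Sum>t\<in>UNIV. \<Sum>r\<in>UNIV. \<Sum>x\<in>UNIV. \<Sum>y\<in>UNIV.
      smul (frame_coeff_hol a m t r * frame_coeff_antihol a' q x y) (E m q * E t r * E x y)) * \<kappa> ^ p"
  have "smul (of_nat (Suc p)) (smul ?n ?X) + smul c (smul (?n * of_nat (Suc p)) ?Y) =
      smul (?n * of_nat (Suc p)) (?X + smul c ?Y)"
    by (simp only: ext.scale_right_distrib ext.scale_scale mult_ac)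
  also have "\<dots> = 0"
    using eq unfolding second_order_sum first_order_sum by (simp only: ext.scale_zero_right)
  finally have "smul (of_nat (Suc p) *
      ((\<Sum>i\<in>UNIV. \<Sum>j\<in>UNIV. H i j * (\<Sum>k\<in>UNIV. \<Sum>l\<in>UNIV. H k l * b i j k l))
       - (\<Sum>i\<in>UNIV. \<Sum>l\<in>UNIV. H i l * (\<Sum>k\<in>UNIV. \<Sum>j\<in>UNIV. H k j * b i j k l)))
      + c * torsion_pairing (frame_coeff_hol a) (frame_coeff_antihol a')) (\<kappa> ^ CARD('n)) = 0"
    unfolding sum_EE_power[OF n] sum_EEE_power[OF n] sum_frame_coeff2_diag sum_frame_coeff2_cross
    by (simp only: ext.scale_left_distrib ext.scale_scale)
  then show ?thesis
    using \<kappa>_power_nonzero ext.scale_eq_0_iff by blast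
qed

end

section \<open>The pairing in terms of torsion norms\<close>

lemma torsion_pairing_cnj:
  fixes A :: "'n::finite \<Rightarrow> 'n \<Rightarrow> 'n \<Rightarrow> complex"
  shows "torsion_pairing A (\<lambda>q x y. cnj (A q y x)) =
    of_real (\<Sum>m\<in>UNIV. (cmod ((\<Sum>t\<in>UNIV. A m t t) - (\<Sum>t\<in>UNIV. A t m t)))\<^sup>2)
    - ((\<Sum>m\<in>UNIV. \<Sum>t\<in>UNIV. \<Sum>r\<in>UNIV. A m t r * cnj (A m t r))
     - (\<Sum>m\<in>UNIV. \<Sum>t\<in>UNIV. \<Sum>r\<in>UNIV. A m t r * cnj (A t m r)))"
proof -
  \<comment> \<open>\<open>u - v\<close> is the trace of the torsion. Four of the six terms of the
    pairing are the expansion of its squared norm; the other two are the difference rewritten by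
    \<open>torsion_norm\<close>.\<close>
  define u v where "u m = (\<Sum>t\<in>UNIV. A m t t)" and "v m = (\<Sum>t\<in>UNIV. A t m t)" for m
  have "(\<Sum>m\<in>UNIV. \<Sum>t\<in>UNIV. \<Sum>x\<in>UNIV. A m t t * cnj (A m x x)) = (\<Sum>m\<in>UNIV. u m * cnj (u m))"
    by (simp add: u_def sum_product)
  moreover have "(\<Sum>m\<in>UNIV. \<Sum>t\<in>UNIV. \<Sum>x\<in>UNIV. A m t m * cnj (A t x x)) = (\<Sum>m\<in>UNIV. v m * cnj (u m))"
    by (subst sum.swap) (simp add: u_def v_def sum_product)
  moreover have "(\<Sum>m\<in>UNIV. \<Sum>q\<in>UNIV. \<Sum>t\<in>UNIV. A m t t * cnj (A q m q)) = (\<Sum>m\<in>UNIV. u m * cnj (v m))"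
    unfolding u_def v_def cnj_sum sum_product by (intro sum.cong refl sum.swap)
  moreover have "(\<Sum>m\<in>UNIV. \<Sum>q\<in>UNIV. \<Sum>t\<in>UNIV. A m t m * cnj (A q t q)) = (\<Sum>m\<in>UNIV. v m * cnj (v m))"
    by (subst sum_swap_pair_single[symmetric]) (simp add: v_def sum_product)
  moreover have "of_real (\<Sum>m\<in>UNIV. (cmod (u m - v m))\<^sup>2) = (\<Sum>m\<in>UNIV. (u m - v m) * cnj (u m - v m))"
    by (simp only: of_real_sum complex_norm_square)
  ultimately show ?thesis
    unfolding torsion_pairing_def u_def[symmetric] v_def[symmetric]
    by (simp add: algebra_simps sum.distrib sum_subtractf)
qed

text \<open>Expanding the square of the antisymmetrisation gives each of the two sums twice, whence
  the factor 1/2.\<close>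

lemma torsion_norm:
  fixes A :: "'n::finite \<Rightarrow> 'n \<Rightarrow> 'n \<Rightarrow> complex"
  shows "(\<Sum>m\<in>UNIV. \<Sum>t\<in>UNIV. \<Sum>r\<in>UNIV. A m t r * cnj (A m t r))
     - (\<Sum>m\<in>UNIV. \<Sum>t\<in>UNIV. \<Sum>r\<in>UNIV. A m t r * cnj (A t m r)) =
    of_real ((\<Sum>m\<in>UNIV. \<Sum>t\<in>UNIV. \<Sum>r\<in>UNIV. (cmod (A m t r - A t m r))\<^sup>2) / 2)"
proof -
  let ?P = "\<Sum>m\<in>UNIV. \<Sum>t\<in>UNIV. \<Sum>r\<in>UNIV. A m t r * cnj (A m t r)"
  let ?R = "\<Sum>m\<in>UNIV. \<Sum>t\<in>UNIV. \<Sum>r\<in>UNIV. A m t r * cnj (A t m r)"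
  have "(\<Sum>m\<in>UNIV. \<Sum>t\<in>UNIV. \<Sum>r\<in>UNIV. A t m r * cnj (A t m r)) = ?P"
    by (rule sum.swap)
  moreover have "(\<Sum>m\<in>UNIV. \<Sum>t\<in>UNIV. \<Sum>r\<in>UNIV. A t m r * cnj (A m t r)) = ?R"
    by (rule sum.swap)
  moreover have "of_real (\<Sum>m\<in>UNIV. \<Sum>t\<in>UNIV. \<Sum>r\<in>UNIV. (cmod (A m t r - A t m r))\<^sup>2) =
      (\<Sum>m\<in>UNIV. \<Sum>t\<in>UNIV. \<Sum>r\<in>UNIV. (A m t r - A t m r) * cnj (A m t r - A t m r))"
    by (simp only: of_real_sum complex_norm_square)
  ultimately have "of_real (\<Sum>m\<in>UNIV. \<Sum>t\<in>UNIV. \<Sum>r\<in>UNIV. (cmod (A m t r - A t m r))\<^sup>2) = 2 * (?P - ?R)"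
    by (simp add: algebra_simps sum.distrib sum_subtractf)
  then show ?thesis
    by simp
qed

section \<open>Frames adapted to a Hermitian matrix\<close>

text \<open>Cholesky factorization: the pivot \<open>a\<close> splits off a rank-one summand, and the remaining Schur
  complement is again positive definite.\<close>
lemma hermitian_factorization_on:
  fixes A :: "'n::finite \<Rightarrow> 'n \<Rightarrow> complex"
  assumes "\<And>i j. i \<in> S \<Longrightarrow> j \<in> S \<Longrightarrow> A j i = cnj (A i j)"
    and "\<And>v. (\<And>i. i \<notin> S \<Longrightarrow> v i = 0) \<Longrightarrow> (\<exists>i. v i \<noteq> 0) \<Longrightarrow>
      0 < Re (\<Sum>i\<in>S. \<Sum>j\<in>S. A i j * v i * cnj (v j))"
  shows "\<exists>W. \<forall>i\<in>S. \<forall>j\<in>S. A i j = (\<Sum>m\<in>S. W m i * cnj (W m j))"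
proof -
  have "finite S" by simp
  then show ?thesis
    using assms
  proof (induction S arbitrary: A rule: finite_induct)
    case empty
    then show ?case by simp
  next
    case (insert a S)
    note herm = insert.prems(1) and pos = insert.prems(2)
    define d where "d = Re (A a a)"
    have Aaa: "A a a = of_real d"
      using herm[of a a] by (simp add: d_def complex_eq_iff)
    have "0 < Re (\<Sum>i\<in>insert a S. \<Sum>j\<in>insert a S.
        A i j * (if i = a then 1 else 0) * cnj (if j = a then 1 else 0))"
      by (rule pos[of "\<lambda>i. if i = a then 1 else 0"]) auto
    moreover have "(\<Sum>i\<in>insert a S. \<Sum>j\<in>insert a S.
        A i j * (if i = a then 1 else 0) * cnj (if j = a then 1 else 0)) = A a a"
      by (simp add: if_distrib[of cnj] if_distrib[of "\<lambda>x. c * x" for c] sum.delta cong: if_cong)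
    ultimately have d: "d > 0"
      by (simp add: d_def)
    define A' where "A' i j = A i j - A i a * A a j / of_real d" for i j
    have "\<exists>W. \<forall>i\<in>S. \<forall>j\<in>S. A' i j = (\<Sum>m\<in>S. W m i * cnj (W m j))"
    proof (rule insert.IH)
      fix i j assume "i \<in> S" "j \<in> S"
      then show "A' j i = cnj (A' i j)"
        using herm[of i j] herm[of a j] herm[of i a] unfolding A'_def by (simp add: mult.commute)
    next
      fix v :: "'n \<Rightarrow> complex"
      assume v: "\<And>i. i \<notin> S \<Longrightarrow> v i = 0" "\<exists>i. v i \<noteq> 0"
      define L where "L = (\<Sum>i\<in>S. A i a * v i)"
      have L': "(\<Sum>j\<in>S. A a j * cnj (v j)) = cnj L"
        unfolding L_def cnj_sum using herm[of _ a] by (intro sum.cong) simp_all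
      \<comment> \<open>This value at the pivot minimises the form over extensions of
        \<open>v\<close>: completing the square leaves exactly the form of the Schur complement
        \<open>A'\<close>.\<close>
      define w where "w i = (if i = a then - L / of_real d else v i)" for i
      have w: "i \<in> S \<Longrightarrow> w i = v i" for i
        using insert.hyps by (auto simp: w_def)
      have "0 < Re (\<Sum>i\<in>insert a S. \<Sum>j\<in>insert a S. A i j * w i * cnj (w j))"
      proof (rule pos)
        show "w i = 0" if "i \<notin> insert a S" for i
          using that v(1) by (simp add: w_def)
        show "\<exists>i. w i \<noteq> 0"
          using v w by metis
      qed
      also have "(\<Sum>i\<in>insert a S. \<Sum>j\<in>insert a S. A i j * w i * cnj (w j)) =
          A a a * w a * cnj (w a) + w a * (\<Sum>j\<in>S. A a j * cnj (v j)) + cnj (w a) * L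
          + (\<Sum>i\<in>S. \<Sum>j\<in>S. A i j * v i * cnj (v j))"
        using insert.hyps w
        by (simp add: L_def sum.distrib sum_distrib_left mult_ac cong: sum.cong)
      also have "\<dots> = (\<Sum>i\<in>S. \<Sum>j\<in>S. A i j * v i * cnj (v j)) - L * cnj L / of_real d"
        using d unfolding L' by (simp add: w_def Aaa field_simps)
      also have "L * cnj L / of_real d = (\<Sum>i\<in>S. \<Sum>j\<in>S. A i a * A a j / of_real d * v i * cnj (v j))"
        unfolding L'[symmetric] by (simp add: L_def sum_product sum_divide_distrib mult_ac)
      also have "(\<Sum>i\<in>S. \<Sum>j\<in>S. A i j * v i * cnj (v j)) - \<dots> =
          (\<Sum>i\<in>S. \<Sum>j\<in>S. A' i j * v i * cnj (v j))"
        by (simp add: A'_def sum_subtractf left_diff_distrib)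
      finally show "0 < Re (\<Sum>i\<in>S. \<Sum>j\<in>S. A' i j * v i * cnj (v j))" .
    qed
    then obtain W :: "'n \<Rightarrow> 'n \<Rightarrow> complex" where W: "\<And>i j. i \<in> S \<Longrightarrow> j \<in> S \<Longrightarrow> A' i j = (\<Sum>m\<in>S. W m i * cnj (W m j))"
      by blast
    \<comment> \<open>Row \<open>a\<close> produces the rank-one summand of the pivot; the other
      rows vanish at \<open>a\<close>, so they contribute only to the Schur complement.\<close>
    define W' where "W' m i = (if m = a then A i a / of_real (sqrt d) else if i = a then 0 else W m i)" for m i
    have sq: "complex_of_real (sqrt d) * complex_of_real (sqrt d) = of_real d"
      using d by (simp flip: of_real_mult)
    have "A i j = (\<Sum>m\<in>insert a S. W' m i * cnj (W' m j))" if ij: "i \<in> insert a S" "j \<in> insert a S" for i j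
    proof -
      have "cnj (A j a) = A a j"
        using herm[of j a] ij by simp
      then have pivot: "W' a i * cnj (W' a j) = A i a * A a j / of_real d"
        by (simp add: W'_def sq)
      have rest: "(\<Sum>m\<in>S. W' m i * cnj (W' m j)) = (if i = a \<or> j = a then 0 else A' i j)"
      proof (cases "i = a \<or> j = a")
        case True
        then show ?thesis
          using insert.hyps by (auto simp: W'_def intro!: sum.neutral)
      next
        case False
        then have "A' i j = (\<Sum>m\<in>S. W m i * cnj (W m j))"
          using W ij by simp
        moreover have "(\<Sum>m\<in>S. W' m i * cnj (W' m j)) = (\<Sum>m\<in>S. W m i * cnj (W m j))"
          using insert.hyps False by (intro sum.cong) (auto simp: W'_def)
        ultimately show ?thesis using False by simp
      qed
      show ?thesis
        using insert.hyps d rest pivot by (auto simp: A'_def Aaa)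
    qed
    then show ?case by blast
  qed
qed

lemma matrix_inv_eqI:
  fixes A B :: "'a::field^'n::finite^'n"
  assumes "A ** B = mat 1"
  shows "matrix_inv A = B"
proof -
  have "B ** A = mat 1"
    using assms matrix_left_right_inverse by blast
  then have "\<exists>A'. A ** A' = mat 1 \<and> A' ** A = mat 1"
    using assms by blast
  then have "A ** matrix_inv A = mat 1 \<and> matrix_inv A ** A = mat 1"
    unfolding matrix_inv_def by (rule someI_ex)
  then show ?thesis
    by (metis assms matrix_mul_assoc matrix_mul_lid matrix_mul_rid)
qed

text \<open>The rows of a factor \<open>W\<close> of \<open>G\<close> form the coframe. A vector in
  the kernel of \<open>W\<close> has length zero for \<open>G\<close>, so positivity makes
  \<open>W\<close> invertible, and its inverse \<open>Q\<close> gives the frame.\<close>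

lemma hermitian_frame:
  fixes G :: "'n::{finite,linorder} cmat"
  assumes herm: "\<And>i j. G $ j $ i = cnj (G $ i $ j)"
    and pos: "\<And>v. v \<noteq> 0 \<Longrightarrow> 0 < Re (\<Sum>i\<in>UNIV. \<Sum>j\<in>UNIV. G $ i $ j * v $ i * cnj (v $ j))"
  obtains W Q :: "'n \<Rightarrow> 'n \<Rightarrow> complex" where "frame W Q"
    and "\<And>k l. G $ k $ l = (\<Sum>m\<in>UNIV. W m k * cnj (W m l))"
    and "\<And>i j. hinv G i j = (\<Sum>m\<in>UNIV. Q i m * cnj (Q j m))"
    and "invertible G"
proof -
  have "\<exists>W :: 'n \<Rightarrow> 'n \<Rightarrow> complex. \<forall>i\<in>UNIV. \<forall>j\<in>UNIV. G $ i $ j = (\<Sum>m\<in>UNIV. W m i * cnj (W m j))"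
  proof (rule hermitian_factorization_on[where A = "\<lambda>i j. G $ i $ j"])
    fix v :: "'n \<Rightarrow> complex"
    assume "\<exists>i. v i \<noteq> 0"
    then have "(\<chi> i. v i) \<noteq> 0"
      by (metis vec_lambda_beta zero_index)
    from pos[OF this] show "0 < Re (\<Sum>i\<in>UNIV. \<Sum>j\<in>UNIV. G $ i $ j * v i * cnj (v j))"
      by simp
  qed (rule herm)
  then obtain W :: "'n \<Rightarrow> 'n \<Rightarrow> complex" where W: "\<And>i j. G $ i $ j = (\<Sum>m\<in>UNIV. W m i * cnj (W m j))"
    by blast
  define M where "M = (\<chi> m k. W m k)"
  have "v = 0" if "M *v v = 0" for v
  proof (rule ccontr)
    assume "v \<noteq> 0"
    have "(\<Sum>k\<in>UNIV. W m k * v $ k) = 0" for m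
      using that by (simp add: M_def matrix_vector_mult_def vec_eq_iff)
    then have "(\<Sum>m\<in>UNIV. (\<Sum>i\<in>UNIV. W m i * v $ i) * cnj (\<Sum>j\<in>UNIV. W m j * v $ j)) = 0"
      by simp
    then have "(\<Sum>m\<in>UNIV. \<Sum>i\<in>UNIV. \<Sum>j\<in>UNIV. W m i * cnj (W m j) * v $ i * cnj (v $ j)) = 0"
      by (simp add: sum_product mult_ac)
    then have "(\<Sum>i\<in>UNIV. \<Sum>j\<in>UNIV. G $ i $ j * v $ i * cnj (v $ j)) = 0"
      unfolding W sum_distrib_right by (subst (asm) sum_swap_pair_single)
    with pos[OF \<open>v \<noteq> 0\<close>] show False by simp
  qed
  then obtain N where "N ** M = mat 1"
    using matrix_left_invertible_ker by blast
  moreover from this have "M ** N = mat 1"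
    using matrix_left_right_inverse by blast
  moreover define Q where "Q i m = N $ i $ m" for i m
  ultimately have Q: "(\<Sum>k\<in>UNIV. W m k * Q k t) = \<delta> m t" "(\<Sum>m\<in>UNIV. Q i m * W m k) = \<delta> i k" for m t i k
    by (auto simp: M_def Q_def matrix_matrix_mult_def mat_def vec_eq_iff)
  \<comment> \<open>The inverse of \<open>G\<close>; the indices are transposed to match the
    convention of \<open>hinv\<close>.\<close>
  define B where "B = (\<chi> l k. \<Sum>m\<in>UNIV. Q k m * cnj (Q l m))"
  have "(\<Sum>l\<in>UNIV. G $ j $ l * B $ l $ k) = \<delta> j k" for j k
  proof -
    have "(\<Sum>l\<in>UNIV. G $ j $ l * B $ l $ k) =
        (\<Sum>l\<in>UNIV. \<Sum>m\<in>UNIV. \<Sum>t\<in>UNIV. W m j * Q k t * cnj (W m l * Q l t))"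
      unfolding W B_def vec_lambda_beta sum_product by (simp add: mult_ac)
    also have "\<dots> = (\<Sum>m\<in>UNIV. \<Sum>t\<in>UNIV. W m j * Q k t * cnj (\<Sum>l\<in>UNIV. W m l * Q l t))"
      by (subst sum_swap_pair_single) (simp add: sum_distrib_left)
    also have "\<dots> = (\<Sum>m\<in>UNIV. Q k m * W m j)"
      unfolding Q(1) by (simp add: kronecker_mult if_distrib[of cnj] if_distrib[of "\<lambda>x. c * x" for c] sum.delta mult.commute cong: if_cong)
    finally show ?thesis
      by (simp add: Q)
  qed
  then have GB: "G ** B = mat 1"
    by (simp add: matrix_matrix_mult_def mat_def vec_eq_iff)
  show ?thesis
  proof
    show "frame W Q"
      by unfold_locales (rule Q)+
    show "hinv G i j = (\<Sum>m\<in>UNIV. Q i m * cnj (Q j m))" for i j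
      unfolding hinv_def matrix_inv_eqI[OF GB] by (simp add: B_def)
    show "invertible G"
      using GB invertible_right_inverse by blast
  qed (rule W)
qed

section \<open>Wirtinger calculus\<close>

text \<open>The parameter c is - \<i> for \<open>pd\<close> and \<i> for \<open>pdbar\<close>, so
  that one calculus serves both.\<close>

definition wirtinger :: "complex \<Rightarrow> 'n::finite \<Rightarrow> ('n cvec \<Rightarrow> complex) \<Rightarrow> 'n cvec \<Rightarrow> complex" where
  "wirtinger c i f x =
    (frechet_derivative f (at x) (axis i 1) + c * frechet_derivative f (at x) (axis i \<i>)) / 2"

lemma pd_eq_wirtinger: "pd = wirtinger (- \<i>)"
  by (simp add: pd_def wirtinger_def fun_eq_iff)

lemma pdbar_eq_wirtinger: "pdbar = wirtinger \<i>"
  by (simp add: pdbar_def wirtinger_def fun_eq_iff)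

lemma wirtinger_has_derivative:
  "(f has_derivative f') (at x) \<Longrightarrow> wirtinger c i f x = (f' (axis i 1) + c * f' (axis i \<i>)) / 2"
  by (simp add: wirtinger_def flip: frechet_derivative_at)

lemma wirtinger_const [simp]: "wirtinger c i (\<lambda>y. d) x = 0"
  by (simp add: wirtinger_def)

lemma wirtinger_sum:
  assumes "finite A" "\<And>a. a \<in> A \<Longrightarrow> f a differentiable (at x)"
  shows "wirtinger c i (\<lambda>y. \<Sum>a\<in>A. f a y) x = (\<Sum>a\<in>A. wirtinger c i (f a) x)"
proof -
  have "((\<lambda>y. \<Sum>a\<in>A. f a y) has_derivative (\<lambda>v. \<Sum>a\<in>A. frechet_derivative (f a) (at x) v)) (at x)"
    using assms by (intro has_derivative_sum) (simp flip: frechet_derivative_works)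
  note deriv = wirtinger_has_derivative[OF this]
  show ?thesis
    unfolding deriv
    by (simp add: wirtinger_def sum.distrib sum_distrib_left flip: sum_divide_distrib)
qed

lemma wirtinger_mult:
  assumes "f differentiable (at x)" "g differentiable (at x)"
  shows "wirtinger c i (\<lambda>y. f y * g y) x = wirtinger c i f x * g x + f x * wirtinger c i g x"
proof -
  have "((\<lambda>y. f y * g y) has_derivative
      (\<lambda>v. f x * frechet_derivative g (at x) v + frechet_derivative f (at x) v * g x)) (at x)"
    using assms by (intro has_derivative_mult) (simp_all flip: frechet_derivative_works)
  note deriv = wirtinger_has_derivative[OF this]
  show ?thesis
    unfolding deriv by (simp add: wirtinger_def field_simps)
qed

lemma wirtinger_cmult:
  assumes "f differentiable (at x)"
  shows "wirtinger c i (\<lambda>y. d * f y) x = d * wirtinger c i f x"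
  using wirtinger_mult[of "\<lambda>y. d" x f c i] assms by simp

lemma wirtinger_local:
  assumes "f differentiable (at x)" "open S" "x \<in> S" "\<And>y. y \<in> S \<Longrightarrow> f y = g y"
  shows "wirtinger c i f x = wirtinger c i g x"
  using frechet_derivative_transform_within_open[OF assms] by (simp add: wirtinger_def)

lemma differentiable_local:
  assumes "f differentiable (at x)" "open S" "x \<in> S" "\<And>y. y \<in> S \<Longrightarrow> f y = g y"
  shows "g differentiable (at x)"
  using assms unfolding differentiable_def by (meson has_derivative_transform_within_open)

text \<open>Conjugating the parameter exchanges \<open>pd\<close> and \<open>pdbar\<close>; combined
  with the hermitian symmetry of the metric it relates their values on its coefficients.\<close>

lemma wirtinger_cnj:
  assumes "f differentiable (at x)"
  shows "wirtinger (cnj c) i (\<lambda>y. cnj (f y)) x = cnj (wirtinger c i f x)"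
proof -
  have "((\<lambda>y. cnj (f y)) has_derivative (\<lambda>v. cnj (frechet_derivative f (at x) v))) (at x)"
    using assms unfolding frechet_derivative_works
    by (rule bounded_linear.has_derivative[OF bounded_linear_cnj])
  from wirtinger_has_derivative[OF this] show ?thesis
    by (simp add: wirtinger_def)
qed

lemma smooth_on_differentiable:
  assumes "smooth_on S f" "x \<in> S"
  shows "f differentiable (at x)"
proof -
  have "Ck_on (Suc 0) S f"
    using assms(1) by (simp add: smooth_on_def del: Ck_on.simps)
  then show ?thesis
    using assms(2) by simp
qed

lemma smooth_on_wirtinger_differentiable:
  assumes "smooth_on S f" "x \<in> S"
  shows "wirtinger c i f differentiable (at x)"
proof -
  have "Ck_on (Suc (Suc 0)) S f"
    using assms(1) by (simp add: smooth_on_def del: Ck_on.simps)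
  then have "(\<lambda>y. frechet_derivative f (at y) v) differentiable (at x)" for v
    using assms(2) by simp
  then show ?thesis
    unfolding wirtinger_def[abs_def] by (intro derivative_intros) auto
qed

lemma differentiable_det:
  fixes M :: "'a::real_normed_vector \<Rightarrow> 'n::finite cmat"
  assumes "\<And>i j. (\<lambda>y. M y $ i $ j) differentiable (at x)"
  shows "(\<lambda>y. det (M y)) differentiable (at x)"
proof -
  have "(\<lambda>y. \<Prod>i\<in>UNIV. M y $ i $ p i) differentiable (at x)" for p
  proof -
    have "((\<lambda>y. M y $ i $ p i) has_derivative frechet_derivative (\<lambda>y. M y $ i $ p i) (at x)) (at x)" for i
      using assms by (simp flip: frechet_derivative_works)
    from has_derivative_prod[OF this, of "\<lambda>i. i" UNIV] show ?thesis
      unfolding differentiable_def by blast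
  qed
  then show ?thesis
    unfolding det_def by (intro differentiable_sum differentiable_mult ballI) simp_all
qed

text \<open>Writing the entries of the inverse as quotients of determinants makes their
  differentiability visible.\<close>

lemma matrix_inv_cramer:
  fixes A :: "'n::finite cmat"
  assumes "invertible A"
  shows "matrix_inv A $ l $ k = det (\<chi> i j. if j = l then \<delta> i k else A $ i $ j) / det A"
proof -
  have det: "det A \<noteq> 0"
    using assms by (simp add: invertible_det_nz)
  obtain B where B: "A ** B = mat 1"
    using assms invertible_right_inverse by blast
  have "A *v (\<chi> l. B $ l $ k) = (\<chi> i. \<delta> i k)"
    using B by (simp add: matrix_matrix_mult_def matrix_vector_mult_def mat_def vec_eq_iff)
  then have "(\<chi> l. B $ l $ k) = (\<chi> l. det (\<chi> i j. if j = l then (\<chi> i. \<delta> i k) $ i else A $ i $ j) / det A)"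
    unfolding cramer[OF det] .
  then have "B $ l $ k = det (\<chi> i j. if j = l then \<delta> i k else A $ i $ j) / det A"
    unfolding vec_eq_iff vec_lambda_beta by blast
  then show ?thesis
    by (simp add: matrix_inv_eqI[OF B])
qed

lemma differentiable_hinv:
  fixes g :: "'n::finite cvec \<Rightarrow> 'n cmat"
  assumes "open S" "x \<in> S" "\<And>i j. (\<lambda>y. g y $ i $ j) differentiable (at x)"
    and "\<And>y. y \<in> S \<Longrightarrow> invertible (g y)"
  shows "(\<lambda>y. hinv (g y) k l) differentiable (at x)"
proof -
  have "(\<lambda>y. det (\<chi> i j. if j = l then \<delta> i k else g y $ i $ j) / det (g y)) differentiable (at x)"
  proof (intro differentiable_divide differentiable_det)
    show "(\<lambda>y. (\<chi> i j. if j = l then \<delta> i k else g y $ i $ j) $ i $ j) differentiable at x" for i j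
      using assms(3) by (cases "j = l") simp_all
    show "det (g x) \<noteq> 0"
      using assms(2,4) by (simp flip: invertible_det_nz)
  qed (rule assms(3))
  then show ?thesis
    using assms(1,2) by (rule differentiable_local) (simp add: hinv_def matrix_inv_cramer assms(4))
qed

section \<open>Wirtinger derivatives of functions with values in forms\<close>

lemma coeff_Ext [simp]: "coeff (Ext a) = a"
  by (simp add: Ext_inverse)

lemma coeff_mult:
  fixes a b :: "'n::{finite,linorder} ext"
  shows "coeff (a * b) I J = (\<Sum>P\<in>Pow I. \<Sum>Q\<in>Pow J.
     (- 1) ^ (card Q * card (I - P)) * shuffle_sign P (I - P) * shuffle_sign Q (J - Q)
       * (coeff a P Q * coeff b (I - P) (J - Q)))"
  by (simp add: times_ext.rep_eq wedge_def mult.assoc)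

definition differentiable_ext :: "('n::finite cvec \<Rightarrow> 'n ext) \<Rightarrow> 'n cvec \<Rightarrow> bool" where
  "differentiable_ext \<alpha> x \<longleftrightarrow> (\<forall>I J. (\<lambda>y. coeff (\<alpha> y) I J) differentiable (at x))"

definition wirtinger_ext ::
    "complex \<Rightarrow> 'n::finite \<Rightarrow> ('n cvec \<Rightarrow> 'n ext) \<Rightarrow> 'n cvec \<Rightarrow> 'n ext" where
  "wirtinger_ext c i \<alpha> x = Ext (\<lambda>I J. wirtinger c i (\<lambda>y. coeff (\<alpha> y) I J) x)"

lemma differentiable_ext_const: "differentiable_ext (\<lambda>y. a) x"
  by (simp add: differentiable_ext_def)

lemma wirtinger_ext_const: "wirtinger_ext c i (\<lambda>y. a) x = 0"
  by (rule ext_eqI) (simp add: wirtinger_ext_def)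

lemma differentiable_ext_mult:
  fixes \<alpha> \<beta> :: "'n::{finite,linorder} cvec \<Rightarrow> 'n ext"
  assumes "differentiable_ext \<alpha> x" "differentiable_ext \<beta> x"
  shows "differentiable_ext (\<lambda>y. \<alpha> y * \<beta> y) x"
  using assms unfolding differentiable_ext_def coeff_mult
  by (intro allI differentiable_sum ballI differentiable_mult) simp_all

lemma wirtinger_ext_mult:
  fixes \<alpha> \<beta> :: "'n::{finite,linorder} cvec \<Rightarrow> 'n ext"
  assumes "differentiable_ext \<alpha> x" "differentiable_ext \<beta> x"
  shows "wirtinger_ext c i (\<lambda>y. \<alpha> y * \<beta> y) x =
    wirtinger_ext c i \<alpha> x * \<beta> x + \<alpha> x * wirtinger_ext c i \<beta> x"
proof (rule ext_eqI)
  fix I J :: "'n set"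
  have diff: "(\<lambda>y. coeff (\<alpha> y) P Q) differentiable (at x)"
    "(\<lambda>y. coeff (\<beta> y) P Q) differentiable (at x)" for P Q
    using assms by (simp_all add: differentiable_ext_def)
  show "coeff (wirtinger_ext c i (\<lambda>y. \<alpha> y * \<beta> y) x) I J =
      coeff (wirtinger_ext c i \<alpha> x * \<beta> x + \<alpha> x * wirtinger_ext c i \<beta> x) I J"
    unfolding wirtinger_ext_def coeff_Ext coeff_simps coeff_mult
    by (simp add: wirtinger_sum wirtinger_cmult wirtinger_mult diff distrib_left sum.distrib)
qed

lemma differentiable_ext_power:
  fixes \<alpha> :: "'n::{finite,linorder} cvec \<Rightarrow> 'n ext"
  assumes "differentiable_ext \<alpha> x"
  shows "differentiable_ext (\<lambda>y. \<alpha> y ^ k) x"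
  by (induction k) (simp_all add: differentiable_ext_const differentiable_ext_mult assms)

text \<open>In a noncommutative ring the power rule requires the value and its derivative to
  commute. For the fundamental form both are of type (1,1), hence they do.\<close>

lemma wirtinger_ext_power:
  fixes \<alpha> :: "'n::{finite,linorder} cvec \<Rightarrow> 'n ext"
  assumes "differentiable_ext \<alpha> x"
    and "\<alpha> x * wirtinger_ext c i \<alpha> x = wirtinger_ext c i \<alpha> x * \<alpha> x"
  shows "wirtinger_ext c i (\<lambda>y. \<alpha> y ^ Suc k) x =
    smul (of_nat (Suc k)) (\<alpha> x ^ k * wirtinger_ext c i \<alpha> x)"
proof (induction k)
  case (Suc k)
  have comm: "wirtinger_ext c i \<alpha> x * \<alpha> x ^ Suc k = \<alpha> x ^ Suc k * wirtinger_ext c i \<alpha> x"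
    using assms(2) by (metis power_commuting_commutes)
  have "wirtinger_ext c i (\<lambda>y. \<alpha> y ^ Suc (Suc k)) x =
      wirtinger_ext c i \<alpha> x * \<alpha> x ^ Suc k + \<alpha> x * smul (of_nat (Suc k)) (\<alpha> x ^ k * wirtinger_ext c i \<alpha> x)"
    unfolding power_Suc[of _ "Suc k"]
    by (simp only: wirtinger_ext_mult differentiable_ext_power assms(1) Suc.IH)
  also have "\<dots> = smul (1 + of_nat (Suc k)) (\<alpha> x ^ Suc k * wirtinger_ext c i \<alpha> x)"
    unfolding comm
    by (simp only: ext.scale_left_distrib ext.scale_one smul_mult_right power_Suc mult.assoc)
  finally show ?case
    by (simp only: of_nat_Suc[of "Suc k"])
qed simp

lemma wirtinger_ext_local:
  assumes "differentiable_ext \<alpha> x" "open S" "x \<in> S" "\<And>y. y \<in> S \<Longrightarrow> \<alpha> y = \<beta> y"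
  shows "wirtinger_ext c i \<alpha> x = wirtinger_ext c i \<beta> x"
proof (rule ext_eqI)
  fix I J
  show "coeff (wirtinger_ext c i \<alpha> x) I J = coeff (wirtinger_ext c i \<beta> x) I J"
    unfolding wirtinger_ext_def coeff_Ext
    by (rule wirtinger_local[OF _ assms(2,3)]) (use assms in \<open>simp_all add: differentiable_ext_def\<close>)
qed

lemma differentiable_ext_sum:
  assumes "\<And>a. a \<in> A \<Longrightarrow> differentiable_ext (f a) x" "finite A"
  shows "differentiable_ext (\<lambda>y. \<Sum>a\<in>A. f a y) x"
  using assms unfolding differentiable_ext_def coeff_sum by (intro allI differentiable_sum) simp_all

lemma wirtinger_ext_sum:
  assumes "\<And>a. a \<in> A \<Longrightarrow> differentiable_ext (f a) x" "finite A"
  shows "wirtinger_ext c i (\<lambda>y. \<Sum>a\<in>A. f a y) x = (\<Sum>a\<in>A. wirtinger_ext c i (f a) x)"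
  by (rule ext_eqI)
    (use assms in \<open>simp add: differentiable_ext_def coeff_sum wirtinger_ext_def wirtinger_sum\<close>)

lemma differentiable_ext_smul:
  "f differentiable (at x) \<Longrightarrow> differentiable_ext (\<lambda>y. smul (f y) a) x"
  by (simp add: differentiable_ext_def)

lemma wirtinger_ext_smul:
  "f differentiable (at x) \<Longrightarrow> wirtinger_ext c i (\<lambda>y. smul (f y) a) x = smul (wirtinger c i f x) a"
  by (rule ext_eqI) (simp add: wirtinger_ext_def wirtinger_mult)

section \<open>Second derivatives of powers of the fundamental form\<close>

definition form11 :: "('n \<Rightarrow> 'n \<Rightarrow> complex) \<Rightarrow> 'n::{finite,linorder} ext" where
  "form11 b = (\<Sum>k\<in>UNIV. \<Sum>l\<in>UNIV. smul (b k l) (dzE k * dzbarE l))"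

lemma form11_cmult: "form11 (\<lambda>k l. c * b k l) = smul c (form11 b)"
  by (simp add: form11_def ext.scale_sum_right)

lemma commute_of_anticommute:
  fixes a b c :: "'a::ring"
  assumes "a * c = - (c * a)" "b * c = - (c * b)"
  shows "a * b * c = c * (a * b)"
proof -
  have "a * b * c = - (a * c * b)"
    using assms(2) by (simp add: mult.assoc)
  also have "\<dots> = c * (a * b)"
    using assms(1) by (simp add: mult.assoc)
  finally show ?thesis .
qed

lemma dzE_dzbarE_commute:
  "dzE k * dzbarE l * (dzE u * dzbarE v) = dzE u * dzbarE v * (dzE k * dzbarE (l :: 'n::{finite,linorder}))"
proof -
  have "dzE k * dzbarE l * dzE u = dzE u * (dzE k * dzbarE l)"
    by (rule commute_of_anticommute) (simp_all add: dzE_anticommute[of k u] dzE_dzbarE_anticommute[of u l])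
  moreover have "dzE k * dzbarE l * dzbarE v = dzbarE v * (dzE k * dzbarE l)"
    by (rule commute_of_anticommute) (rule dzE_dzbarE_anticommute dzbarE_anticommute)+
  ultimately show ?thesis
    by (simp only: mult.assoc[of "dzE u"] flip: mult.assoc[of "dzE k * dzbarE l"])
qed

lemma form11_commute: "form11 b * form11 c = form11 c * form11 b"
proof -
  have "form11 b * form11 c = (\<Sum>k\<in>UNIV. \<Sum>l\<in>UNIV. \<Sum>u\<in>UNIV. \<Sum>v\<in>UNIV.
      smul (b u v * c k l) (dzE u * dzbarE v * (dzE k * dzbarE l)))"
    by (simp add: form11_def sum_distrib_left sum_distrib_right ext.scale_sum_right mult.commute)
  also have "\<dots> = (\<Sum>u\<in>UNIV. \<Sum>v\<in>UNIV. \<Sum>k\<in>UNIV. \<Sum>l\<in>UNIV.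
      smul (b u v * c k l) (dzE u * dzbarE v * (dzE k * dzbarE l)))"
    by (rule sum_swap_pairs)
  also have "\<dots> = form11 c * form11 b"
    by (simp add: form11_def sum_distrib_left sum_distrib_right ext.scale_sum_right mult.commute
        dzE_dzbarE_commute)
  finally show ?thesis .
qed

lemma form11_commute_power: "form11 b ^ k * form11 c = form11 c * form11 b ^ k"
  using form11_commute power_commuting_commutes by metis

lemma differentiable_ext_form11:
  "(\<And>k l. f k l differentiable (at x)) \<Longrightarrow> differentiable_ext (\<lambda>y. form11 (\<lambda>k l. f k l y)) x"
  unfolding form11_def by (intro differentiable_ext_sum differentiable_ext_smul) simp_all

lemma wirtinger_ext_form11:
  assumes "\<And>k l. f k l differentiable (at x)"
  shows "wirtinger_ext c i (\<lambda>y. form11 (\<lambda>k l. f k l y)) x = form11 (\<lambda>k l. wirtinger c i (f k l) x)"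
  using assms unfolding form11_def
  by (simp add: wirtinger_ext_sum wirtinger_ext_smul differentiable_ext_sum differentiable_ext_smul)

lemma wirtinger_ext_left_mult:
  "differentiable_ext \<alpha> x \<Longrightarrow> wirtinger_ext c i (\<lambda>y. a * \<alpha> y) x = a * wirtinger_ext c i \<alpha> x"
  by (simp add: wirtinger_ext_mult differentiable_ext_const wirtinger_ext_const)

section \<open>Forms as coefficient functions and as ring elements\<close>

lemma fundamental_form_eq: "fundamental_form g z = coeff (form11 (\<lambda>k l. \<i> * g z $ k $ l))"
  by (simp add: fun_eq_iff fundamental_form_def form11_def coeff_sum times_ext.rep_eq dzE.rep_eq dzbarE.rep_eq)

lemma wedge_power_coeff: "wedge_power (coeff x) k = coeff (x ^ k)"
  by (induction k) (simp_all add: one_ext.rep_eq times_ext.rep_eq)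

lemma delbar_coeff: "delbar (\<lambda>y. coeff (\<alpha> y)) z = coeff (\<Sum>j\<in>UNIV. dzbarE j * wirtinger_ext \<i> j \<alpha> z)"
  by (simp add: fun_eq_iff delbar_def coeff_sum times_ext.rep_eq dzbarE.rep_eq wirtinger_ext_def
      pdbar_eq_wirtinger)

lemma del_coeff: "del (\<lambda>y. coeff (\<alpha> y)) z = coeff (\<Sum>i\<in>UNIV. dzE i * wirtinger_ext (- \<i>) i \<alpha> z)"
  by (simp add: fun_eq_iff del_def coeff_sum times_ext.rep_eq dzE.rep_eq wirtinger_ext_def
      pd_eq_wirtinger)

lemma coeff_wedge: "coeff x \<and>\<^sub>f coeff y = coeff (x * y)"
  by (simp add: times_ext.rep_eq)

lemma (in frame) \<kappa>_eq: "\<kappa> = form11 (\<lambda>k l. \<Sum>m\<in>UNIV. W m k * cnj (W m l))"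
proof -
  have "\<kappa> = (\<Sum>m\<in>UNIV. \<Sum>k\<in>UNIV. \<Sum>l\<in>UNIV. smul (W m k * cnj (W m l)) (dzE k * dzbarE l))"
    by (simp add: \<kappa>_def E_def \<theta>_def \<theta>b_def sum_product mult.commute)
  also have "\<dots> = (\<Sum>k\<in>UNIV. \<Sum>l\<in>UNIV. \<Sum>m\<in>UNIV. smul (W m k * cnj (W m l)) (dzE k * dzbarE l))"
    by (rule sum_swap_pair_single)
  finally show ?thesis
    by (simp only: form11_def ext.scale_sum_left)
qed

text \<open>The data that one chart provides; the comparison of the scalar curvatures is carried out
  at a point of such a domain.\<close>

locale hermitian_domain =
  fixes S :: "'n::{finite,linorder} cvec set" and g :: "'n cvec \<Rightarrow> 'n cmat"
  assumes open_domain: "open S"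
    and smooth: "smooth_on S (\<lambda>z. g z $ i $ j)"
    and hermitian: "z \<in> S \<Longrightarrow> g z $ j $ i = cnj (g z $ i $ j)"
    and positive: "z \<in> S \<Longrightarrow> v \<noteq> 0 \<Longrightarrow>
      0 < Re (\<Sum>i\<in>UNIV. \<Sum>j\<in>UNIV. g z $ i $ j * v $ i * cnj (v $ j))"
begin

definition \<omega> :: "'n cvec \<Rightarrow> 'n ext" where "\<omega> z = form11 (\<lambda>k l. \<i> * g z $ k $ l)"

definition a where "a z i k l = pd i (\<lambda>y. g y $ k $ l) z"

definition b where "b z i j k l = pd i (\<lambda>y. pdbar j (\<lambda>w. g w $ k $ l) y) z"

lemma g_differentiable: "z \<in> S \<Longrightarrow> (\<lambda>y. g y $ k $ l) differentiable (at z)"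
  by (rule smooth_on_differentiable[OF smooth])

lemma pdbar_g: "z \<in> S \<Longrightarrow> pdbar j (\<lambda>y. g y $ k $ l) z = cnj (a z j l k)"
proof -
  assume z: "z \<in> S"
  have "pdbar j (\<lambda>y. g y $ k $ l) z = wirtinger (cnj (- \<i>)) j (\<lambda>y. cnj (g y $ l $ k)) z"
    unfolding pdbar_eq_wirtinger complex_cnj_minus complex_cnj_i minus_minus
    by (rule wirtinger_local[OF g_differentiable[OF z] open_domain z hermitian])
  then show ?thesis
    by (simp only: a_def pd_eq_wirtinger wirtinger_cnj g_differentiable[OF z])
qed

lemma pd_g_differentiable: "z \<in> S \<Longrightarrow> (\<lambda>y. pd i (\<lambda>w. g w $ k $ l) y) differentiable (at z)"
  unfolding pd_eq_wirtinger by (rule smooth_on_wirtinger_differentiable[OF smooth])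

lemma pdbar_g_differentiable: "z \<in> S \<Longrightarrow> (\<lambda>y. pdbar j (\<lambda>w. g w $ k $ l) y) differentiable (at z)"
  unfolding pdbar_eq_wirtinger by (rule smooth_on_wirtinger_differentiable[OF smooth])

text \<open>The curvature contains the second derivatives in the opposite order to \<open>b\<close>; the hermitian symmetry of
  \<open>g\<close> relates the two by conjugation, so that the symmetry of second derivatives is not needed.\<close>
lemma pdbar_pd_g:
  assumes z: "z \<in> S"
  shows "pdbar j (\<lambda>y. pd i (\<lambda>w. g w $ k $ l) y) z = cnj (b z j i l k)"
proof -
  have "pd i (\<lambda>w. g w $ k $ l) y = cnj (pdbar i (\<lambda>w. g w $ l $ k) y)" if "y \<in> S" for y
    using pdbar_g[OF that] by (simp add: a_def)
  then have "pdbar j (\<lambda>y. pd i (\<lambda>w. g w $ k $ l) y) z =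
      wirtinger (cnj (- \<i>)) j (\<lambda>y. cnj (pdbar i (\<lambda>w. g w $ l $ k) y)) z"
    unfolding pdbar_eq_wirtinger complex_cnj_minus complex_cnj_i minus_minus
    by (intro wirtinger_local[OF pd_g_differentiable[OF z] open_domain z])
  then show ?thesis
    by (simp only: b_def pd_eq_wirtinger wirtinger_cnj pdbar_g_differentiable[OF z])
qed

lemma differentiable_\<omega>: "z \<in> S \<Longrightarrow> differentiable_ext \<omega> z"
  unfolding \<omega>_def by (intro differentiable_ext_form11 differentiable_mult g_differentiable) simp_all

lemma wirtinger_ext_\<omega>:
  "z \<in> S \<Longrightarrow> wirtinger_ext c i \<omega> z = form11 (\<lambda>k l. \<i> * wirtinger c i (\<lambda>y. g y $ k $ l) z)"
  unfolding \<omega>_def by (simp add: wirtinger_ext_form11 wirtinger_cmult g_differentiable)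

lemma wirtinger_ext_\<omega>_power:
  assumes "z \<in> S"
  shows "wirtinger_ext c i (\<lambda>y. \<omega> y ^ Suc m) z =
    smul (of_nat (Suc m)) (\<omega> z ^ m * form11 (\<lambda>k l. \<i> * wirtinger c i (\<lambda>y. g y $ k $ l) z))"
proof -
  have "\<omega> z * wirtinger_ext c i \<omega> z = wirtinger_ext c i \<omega> z * \<omega> z"
    unfolding wirtinger_ext_\<omega>[OF assms] unfolding \<omega>_def by (rule form11_commute)
  from wirtinger_ext_power[OF differentiable_\<omega>[OF assms] this] show ?thesis
    unfolding wirtinger_ext_\<omega>[OF assms] .
qed

text \<open>The power rule handles the inner operator and the product rule the outer one. The
  derivative of \<open>\<omega> y ^ m\<close> is left unevaluated because \<open>m\<close> may be 0,
  where the power rule for \<open>Suc\<close> does not apply.\<close>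

lemma ddbar_power_eq:
  assumes z: "z \<in> S"
  shows "ddbar_power g (Suc m) z = coeff (smul (of_nat (Suc m)) (\<Sum>i\<in>UNIV. \<Sum>j\<in>UNIV. dzE i * dzbarE j *
      (wirtinger_ext (- \<i>) i (\<lambda>y. \<omega> y ^ m) z * form11 (\<lambda>k l. \<i> * pdbar j (\<lambda>y. g y $ k $ l) z)
       + \<omega> z ^ m * form11 (\<lambda>k l. \<i> * b z i j k l))))"
proof -
  define X where "X j y = form11 (\<lambda>k l. \<i> * pdbar j (\<lambda>w. g w $ k $ l) y)" for j y
  define F where "F y = (\<Sum>j\<in>UNIV. smul (of_nat (Suc m)) (dzbarE j) * (\<omega> y ^ m * X j y))" for y
  have diff: "differentiable_ext (\<lambda>y. \<omega> y ^ m) z" "differentiable_ext (X j) z" for j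
    using z unfolding X_def
    by (intro differentiable_ext_power differentiable_\<omega> differentiable_ext_form11
        differentiable_mult pdbar_g_differentiable; simp)+
  have X: "wirtinger_ext (- \<i>) i (X j) z = form11 (\<lambda>k l. \<i> * b z i j k l)" for i j
    unfolding X_def b_def pd_eq_wirtinger
    by (simp add: wirtinger_ext_form11 wirtinger_cmult pdbar_g_differentiable z)
  have F: "(\<Sum>j\<in>UNIV. dzbarE j * wirtinger_ext \<i> j (\<lambda>y. \<omega> y ^ Suc m) y) = F y" if "y \<in> S" for y
    unfolding F_def X_def pdbar_eq_wirtinger
    by (simp only: wirtinger_ext_\<omega>_power[OF that] smul_mult_right smul_mult_left)
  have "differentiable_ext F z"
    unfolding F_def by (intro differentiable_ext_sum differentiable_ext_mult diff differentiable_ext_const) simp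
  \<comment> \<open>The formula \<open>F\<close> for the inner derivative is known only on
    \<open>S\<close>; openness of \<open>S\<close> allows it to be differentiated once more.\<close>
  then have "wirtinger_ext (- \<i>) i (\<lambda>y. \<Sum>j\<in>UNIV. dzbarE j * wirtinger_ext \<i> j (\<lambda>y. \<omega> y ^ Suc m) y) z =
      wirtinger_ext (- \<i>) i F z" for i
    by (rule wirtinger_ext_local[OF _ open_domain z F[symmetric], symmetric])
  also have "wirtinger_ext (- \<i>) i F z = (\<Sum>j\<in>UNIV. smul (of_nat (Suc m)) (dzbarE j) *
      (wirtinger_ext (- \<i>) i (\<lambda>y. \<omega> y ^ m) z * X j z + \<omega> z ^ m * form11 (\<lambda>k l. \<i> * b z i j k l)))" for i
    unfolding F_def
    by (simp add: wirtinger_ext_sum wirtinger_ext_left_mult wirtinger_ext_mult differentiable_ext_mult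
        differentiable_ext_const diff X del: smul_mult_left of_nat_Suc)
  finally have "(\<Sum>i\<in>UNIV. dzE i * wirtinger_ext (- \<i>) i
      (\<lambda>y. \<Sum>j\<in>UNIV. dzbarE j * wirtinger_ext \<i> j (\<lambda>y. \<omega> y ^ Suc m) y) z) =
    smul (of_nat (Suc m)) (\<Sum>i\<in>UNIV. \<Sum>j\<in>UNIV. dzE i * dzbarE j *
      (wirtinger_ext (- \<i>) i (\<lambda>y. \<omega> y ^ m) z * X j z + \<omega> z ^ m * form11 (\<lambda>k l. \<i> * b z i j k l)))"
    by (simp add: sum_distrib_left ext.scale_sum_right mult.assoc)
  then show ?thesis
    unfolding ddbar_power_def fundamental_form_eq \<omega>_def[symmetric] wedge_power_coeff delbar_coeff del_coeff X_def
    by simp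
qed

text \<open>Here k = m + 1 and n = p + 3. Since (1,1)-forms commute, all powers of \<omega> collect
  on the right, and their total exponent is independent of \<open>m\<close>.\<close>

lemma gauduchon_expansion:
  assumes z: "z \<in> S" and n: "CARD('n) = Suc (Suc (Suc p))" and m: "m \<le> Suc p"
  shows "ddbar_power g (Suc m) z \<and>\<^sub>f wedge_power (fundamental_form g z) (CARD('n) - Suc m - 1) =
    coeff (smul (of_nat (Suc m))
     ((\<Sum>i\<in>UNIV. \<Sum>j\<in>UNIV. dzE i * dzbarE j * form11 (\<lambda>k l. \<i> * b z i j k l)) * \<omega> z ^ Suc p
      + smul (of_nat m) ((\<Sum>i\<in>UNIV. \<Sum>j\<in>UNIV. dzE i * dzbarE j *
        (form11 (\<lambda>k l. \<i> * a z i k l) * form11 (\<lambda>k l. \<i> * cnj (a z j l k)))) * \<omega> z ^ p)))"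
proof -
  define d where "d = Suc p - m"
  have d: "CARD('n) - Suc m - 1 = d" "m + d = Suc p"
    using n m by (simp_all add: d_def)
  define Y where "Y i j = form11 (\<lambda>k l. \<i> * b z i j k l)" for i j
  define Z where "Z i = form11 (\<lambda>k l. \<i> * a z i k l)" for i
  define X where "X j = form11 (\<lambda>k l. \<i> * cnj (a z j l k))" for j
  have comm: "\<omega> z ^ k * Y i j = Y i j * \<omega> z ^ k" "\<omega> z ^ k * Z i = Z i * \<omega> z ^ k"
    "\<omega> z ^ k * X j = X j * \<omega> z ^ k" for i j k
    unfolding Y_def Z_def X_def \<omega>_def by (rule form11_commute_power)+
  have second: "\<omega> z ^ m * Y i j * \<omega> z ^ d = Y i j * \<omega> z ^ Suc p" for i j
    unfolding comm by (simp only: mult.assoc power_add[symmetric] d)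
  have first: "wirtinger_ext (- \<i>) i (\<lambda>y. \<omega> y ^ m) z * X j * \<omega> z ^ d =
      smul (of_nat m) (Z i * X j * \<omega> z ^ p)" for i j
  proof (cases m)
    case 0
    then show ?thesis by (simp add: wirtinger_ext_const)
  next
    case (Suc q)
    then have "q + d = p" using d by simp
    have "wirtinger_ext (- \<i>) i (\<lambda>y. \<omega> y ^ m) z = smul (of_nat m) (\<omega> z ^ q * Z i)"
      unfolding Suc wirtinger_ext_\<omega>_power[OF z] Z_def a_def pd_eq_wirtinger ..
    moreover have "\<omega> z ^ q * Z i * X j * \<omega> z ^ d = Z i * X j * \<omega> z ^ p"
      by (metis comm(2,3) mult.assoc power_add \<open>q + d = p\<close>)
    ultimately show ?thesis by simp
  qed
  have "(\<Sum>i\<in>UNIV. \<Sum>j\<in>UNIV. dzE i * dzbarE j *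
      (wirtinger_ext (- \<i>) i (\<lambda>y. \<omega> y ^ m) z * X j + \<omega> z ^ m * Y i j)) * \<omega> z ^ d =
    (\<Sum>i\<in>UNIV. \<Sum>j\<in>UNIV. dzE i * dzbarE j * (smul (of_nat m) (Z i * X j * \<omega> z ^ p) + Y i j * \<omega> z ^ Suc p))"
    by (simp only: sum_distrib_right mult.assoc[of "dzE i * dzbarE j" for i j] distrib_right first second)
  also have "\<dots> = (\<Sum>i\<in>UNIV. \<Sum>j\<in>UNIV. dzE i * dzbarE j * Y i j) * \<omega> z ^ Suc p
      + smul (of_nat m) ((\<Sum>i\<in>UNIV. \<Sum>j\<in>UNIV. dzE i * dzbarE j * (Z i * X j)) * \<omega> z ^ p)"
    by (simp add: sum_distrib_right ext.scale_sum_right distrib_left sum.distrib mult.assoc add.commute del: power_Suc)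
  finally show ?thesis
    unfolding ddbar_power_eq[OF z] fundamental_form_eq \<omega>_def[symmetric] wedge_power_coeff coeff_wedge d(1)
      pdbar_g[OF z] Y_def X_def Z_def
    by simp
qed

end

section \<open>Scalar curvatures\<close>

lemma sum_rotate4:
  "(\<Sum>j\<in>J. \<Sum>k\<in>K. \<Sum>l\<in>L. \<Sum>i\<in>I. f i j k l) =
    (\<Sum>i\<in>I. \<Sum>j\<in>J. \<Sum>k\<in>K. \<Sum>l\<in>L. (f i j k l :: 'b::comm_monoid_add))"
proof -
  have "(\<Sum>j\<in>J. \<Sum>k\<in>K. \<Sum>l\<in>L. \<Sum>i\<in>I. f i j k l) = (\<Sum>j\<in>J. \<Sum>i\<in>I. \<Sum>k\<in>K. \<Sum>l\<in>L. f i j k l)"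
    by (intro sum.cong refl sum_swap_pair_single[symmetric])
  also have "\<dots> = (\<Sum>i\<in>I. \<Sum>j\<in>J. \<Sum>k\<in>K. \<Sum>l\<in>L. f i j k l)"
    by (rule sum.swap)
  finally show ?thesis .
qed

lemma smul_power: "smul c (x :: 'n::{finite,linorder} ext) ^ k = smul (c ^ k) (x ^ k)"
  by (induction k) (simp_all add: mult.commute)

context hermitian_domain
begin

lemma invertible_g: "z \<in> S \<Longrightarrow> invertible (g z)"
  using hermitian_frame[of "g z", OF hermitian positive] by blast

lemma hinv_contract:
  assumes "z \<in> S"
  shows "(\<Sum>p\<in>UNIV. g z $ p $ l * hinv (g z) p q) = \<delta> q l"
proof -
  obtain B where B: "g z ** B = mat 1"
    using invertible_g[OF assms] invertible_right_inverse by blast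
  then have "B ** g z = mat 1"
    using matrix_left_right_inverse by blast
  then have "(\<Sum>p\<in>UNIV. B $ q $ p * g z $ p $ l) = \<delta> q l"
    by (simp add: matrix_matrix_mult_def mat_def vec_eq_iff)
  then show ?thesis
    by (simp add: hinv_def matrix_inv_eqI[OF B] mult.commute)
qed

text \<open>Lowering the index of the Christoffel symbol cancels the inverse metric. Differentiating
  this identity gives the curvature without a derivative of the inverse metric.\<close>

lemma christoffel_contract:
  assumes "z \<in> S"
  shows "(\<Sum>p\<in>UNIV. g z $ p $ l * christoffel g i k p z) = pd i (\<lambda>y. g y $ k $ l) z"
proof -
  have "(\<Sum>p\<in>UNIV. g z $ p $ l * christoffel g i k p z) =
      (\<Sum>q\<in>UNIV. (\<Sum>p\<in>UNIV. g z $ p $ l * hinv (g z) p q) * pd i (\<lambda>y. g y $ k $ q) z)"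
    unfolding christoffel_def sum_distrib_left sum_distrib_right
    by (subst sum.swap) (simp add: mult.assoc)
  then show ?thesis
    by (simp add: hinv_contract[OF assms] kronecker_mult)
qed

lemma christoffel_differentiable:
  assumes "z \<in> S"
  shows "christoffel g i k p differentiable (at z)"
  unfolding christoffel_def[abs_def] using assms
  by (intro differentiable_sum ballI differentiable_mult pd_g_differentiable
      differentiable_hinv[OF open_domain] g_differentiable invertible_g) simp_all

text \<open>Apply \<open>pdbar j\<close> to \<open>christoffel_contract\<close>: the product rule
  yields minus the curvature plus the term in which the metric is differentiated, and that term is
  quadratic in the first derivatives.\<close>

lemma chern_curv_eq:
  assumes z: "z \<in> S"
  shows "chern_curv g i j k l z =
    - cnj (b z j i l k) + (\<Sum>p\<in>UNIV. \<Sum>q\<in>UNIV. hinv (g z) p q * (a z i k q * cnj (a z j l p)))"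
proof -
  have "wirtinger \<i> j (\<lambda>y. \<Sum>p\<in>UNIV. g y $ p $ l * christoffel g i k p y) z = cnj (b z j i l k)"
    unfolding pdbar_pd_g[OF z, symmetric] pdbar_eq_wirtinger
    by (rule wirtinger_local[OF pd_g_differentiable[OF z] open_domain z, symmetric])
      (simp add: christoffel_contract)
  moreover have "wirtinger \<i> j (\<lambda>y. \<Sum>p\<in>UNIV. g y $ p $ l * christoffel g i k p y) z =
      (\<Sum>p\<in>UNIV. cnj (a z j l p) * christoffel g i k p z)
      + (\<Sum>p\<in>UNIV. g z $ p $ l * pdbar j (christoffel g i k p) z)"
    using z pdbar_g[OF z, unfolded pdbar_eq_wirtinger]
    by (simp add: wirtinger_sum wirtinger_mult g_differentiable christoffel_differentiable
        sum.distrib pdbar_eq_wirtinger)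
  moreover have "(\<Sum>p\<in>UNIV. cnj (a z j l p) * christoffel g i k p z) =
      (\<Sum>p\<in>UNIV. \<Sum>q\<in>UNIV. hinv (g z) p q * (a z i k q * cnj (a z j l p)))"
    by (simp add: christoffel_def a_def sum_distrib_left mult_ac)
  ultimately show ?thesis
    by (simp add: chern_curv_def algebra_simps)
qed

lemma scalar_curv_ge_hat_at:
  assumes z: "z \<in> S" and n: "CARD('n) = Suc (Suc (Suc p))" and m: "m \<le> Suc p"
    and zero: "ddbar_power g (Suc m) z \<and>\<^sub>f wedge_power (fundamental_form g z) (CARD('n) - Suc m - 1) =
      (\<lambda>I J. 0)"
  shows "scalar_curv_hat g z \<le> scalar_curv g z"
proof -
  obtain W Q where "frame W Q"
    and W: "\<And>k l. g z $ k $ l = (\<Sum>m\<in>UNIV. W m k * cnj (W m l))"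
    and Q: "\<And>i j. hinv (g z) i j = (\<Sum>m\<in>UNIV. Q i m * cnj (Q j m))"
    by (rule hermitian_frame[of "g z", OF hermitian[OF z]]) (rule positive[OF z], assumption, rule that)
  interpret frame W Q by fact
  have H: "hinv (g z) = H"
    by (simp add: fun_eq_iff Q H_def)
  have cnj_H: "cnj (H i j) = H j i" for i j
    by (simp add: H_def mult.commute)
  define a' where "a' j k l = cnj (a z j l k)" for j k l
  let ?T1 = "\<Sum>i\<in>UNIV. \<Sum>j\<in>UNIV. H i j * (\<Sum>k\<in>UNIV. \<Sum>l\<in>UNIV. H k l * b z i j k l)"
  let ?T2 = "\<Sum>i\<in>UNIV. \<Sum>l\<in>UNIV. H i l * (\<Sum>k\<in>UNIV. \<Sum>j\<in>UNIV. H k j * b z i j k l)"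
  let ?A = "frame_coeff_hol (a z)"
  let ?P1 = "\<Sum>m\<in>UNIV. \<Sum>t\<in>UNIV. \<Sum>r\<in>UNIV. ?A m t r * cnj (?A m t r)"
  let ?P2 = "\<Sum>m\<in>UNIV. \<Sum>t\<in>UNIV. \<Sum>r\<in>UNIV. ?A m t r * cnj (?A t m r)"
  define N where "N = (\<Sum>m\<in>UNIV. \<Sum>t\<in>UNIV. \<Sum>r\<in>UNIV. (cmod (?A m t r - ?A t m r))\<^sup>2) / 2"
  define \<tau> where "\<tau> = (\<Sum>m\<in>UNIV. (cmod ((\<Sum>t\<in>UNIV. ?A m t t) - (\<Sum>t\<in>UNIV. ?A t m t)))\<^sup>2)"
  have antihol_a': "frame_coeff_antihol a' q x y = cnj (?A q y x)" for q x y
    unfolding a'_def by (rule frame_coeff_antihol_cnj)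
  have N: "?P1 - ?P2 = of_real N"
    unfolding N_def by (rule torsion_norm)
  have \<omega>: "\<omega> z = smul \<i> \<kappa>"
    unfolding \<omega>_def form11_cmult \<kappa>_eq W ..
  define X where "X = (\<Sum>i\<in>UNIV. \<Sum>j\<in>UNIV. dzE i * dzbarE j * form11 (b z i j))"
  define Y where "Y = (\<Sum>i\<in>UNIV. \<Sum>j\<in>UNIV. dzE i * dzbarE j * (form11 (a z i) * form11 (a' j)))"
  \<comment> \<open>Both summands contain the same number p + 2 of factors \<i>: one from
    \<open>b\<close> and p + 1 from \<omega>, or two from the first derivatives and p from \<omega>.
    A common nonzero scalar splits off.\<close>
  have "(\<Sum>i\<in>UNIV. \<Sum>j\<in>UNIV. dzE i * dzbarE j * form11 (\<lambda>k l. \<i> * b z i j k l)) * \<omega> z ^ Suc p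
      + smul (of_nat m) ((\<Sum>i\<in>UNIV. \<Sum>j\<in>UNIV. dzE i * dzbarE j *
        (form11 (\<lambda>k l. \<i> * a z i k l) * form11 (\<lambda>k l. \<i> * a' j k l))) * \<omega> z ^ p) =
      smul (\<i> * \<i> ^ Suc p) (X * \<kappa> ^ Suc p + smul (of_nat m) (Y * \<kappa> ^ p))"
    unfolding form11_cmult \<omega> smul_power X_def Y_def
    by (simp add: ext.scale_right_distrib sum_negf mult_ac flip: ext.scale_sum_right)
  moreover have "(\<Sum>i\<in>UNIV. \<Sum>j\<in>UNIV. dzE i * dzbarE j * form11 (\<lambda>k l. \<i> * b z i j k l)) * \<omega> z ^ Suc p
      + smul (of_nat m) ((\<Sum>i\<in>UNIV. \<Sum>j\<in>UNIV. dzE i * dzbarE j *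
        (form11 (\<lambda>k l. \<i> * a z i k l) * form11 (\<lambda>k l. \<i> * a' j k l))) * \<omega> z ^ p) = 0"
  proof -
    have "smul (of_nat (Suc m)) ((\<Sum>i\<in>UNIV. \<Sum>j\<in>UNIV. dzE i * dzbarE j * form11 (\<lambda>k l. \<i> * b z i j k l)) * \<omega> z ^ Suc p
      + smul (of_nat m) ((\<Sum>i\<in>UNIV. \<Sum>j\<in>UNIV. dzE i * dzbarE j *
        (form11 (\<lambda>k l. \<i> * a z i k l) * form11 (\<lambda>k l. \<i> * a' j k l))) * \<omega> z ^ p)) = 0"
      using zero unfolding gauduchon_expansion[OF z n m] a'_def
      by (intro ext_eqI) (simp only: coeff_simps)
    then show ?thesis
      unfolding ext.scale_eq_0_iff of_nat_eq_0_iff by blast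
  qed
  ultimately have "X * \<kappa> ^ Suc p + smul (of_nat m) (Y * \<kappa> ^ p) = 0"
    by (metis ext.scale_eq_0_iff complex_i_not_zero mult_eq_0_iff power_not_zero)
  then have "of_nat (Suc p) * (?T1 - ?T2) + of_nat m * torsion_pairing ?A (frame_coeff_antihol a') = 0"
    unfolding X_def Y_def form11_def by (rule trace_identity[OF n])
  moreover have "torsion_pairing ?A (frame_coeff_antihol a') = of_real (\<tau> - N)"
  proof -
    have "frame_coeff_antihol a' = (\<lambda>q x y. cnj (?A q y x))"
      by (simp add: fun_eq_iff antihol_a')
    then show ?thesis
      unfolding \<tau>_def of_real_diff N[symmetric] by (simp only: torsion_pairing_cnj)
  qed
  \<comment> \<open>Solving for the difference of traces is the only place where the Gauduchon
    condition enters; it also shows that this difference is real.\<close>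
  ultimately have T: "?T1 - ?T2 = of_real (real m * (N - \<tau>) / real (Suc p))"
    by (simp add: field_simps del: of_nat_Suc)
  have "scalar_curv g z = - cnj ?T1 + ?P1"
  proof -
    have "scalar_curv g z = - (\<Sum>i\<in>UNIV. \<Sum>j\<in>UNIV. \<Sum>k\<in>UNIV. \<Sum>l\<in>UNIV. H i j * H k l * cnj (b z j i l k))
        + (\<Sum>i\<in>UNIV. \<Sum>j\<in>UNIV. H i j * (\<Sum>k\<in>UNIV. \<Sum>l\<in>UNIV. H k l *
            (\<Sum>p\<in>UNIV. \<Sum>q\<in>UNIV. H p q * (a z i k q * a' j p l))))"
      unfolding scalar_curv_def chern_curv_eq[OF z] H a'_def
      by (simp add: distrib_left right_diff_distrib sum.distrib sum_negf sum_subtractf sum_distrib_left mult.assoc)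
    \<comment> \<open>Conjugation swaps the indices within each pair of \<open>b\<close> and within
      each \<open>H\<close>, so the sums are reordered accordingly.\<close>
    also have "(\<Sum>i\<in>UNIV. \<Sum>j\<in>UNIV. \<Sum>k\<in>UNIV. \<Sum>l\<in>UNIV. H i j * H k l * cnj (b z j i l k)) =
        (\<Sum>j\<in>UNIV. \<Sum>i\<in>UNIV. \<Sum>l\<in>UNIV. \<Sum>k\<in>UNIV. H i j * H k l * cnj (b z j i l k))"
      by (subst sum.swap) (intro sum.cong refl sum.swap)
    also have "\<dots> = cnj ?T1"
      by (simp add: cnj_H sum_distrib_left mult.assoc)
    also have "(\<Sum>i\<in>UNIV. \<Sum>j\<in>UNIV. H i j * (\<Sum>k\<in>UNIV. \<Sum>l\<in>UNIV. H k l *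
            (\<Sum>p\<in>UNIV. \<Sum>q\<in>UNIV. H p q * (a z i k q * a' j p l)))) = ?P1"
      unfolding sum_frame_coeff3_diag[symmetric] antihol_a' ..
    finally show ?thesis .
  qed
  moreover have "scalar_curv_hat g z = - cnj ?T2 + ?P2"
  proof -
    have "scalar_curv_hat g z = - (\<Sum>i\<in>UNIV. \<Sum>j\<in>UNIV. \<Sum>k\<in>UNIV. \<Sum>l\<in>UNIV. H i l * H k j * cnj (b z j i l k))
        + (\<Sum>i\<in>UNIV. \<Sum>j\<in>UNIV. \<Sum>k\<in>UNIV. \<Sum>l\<in>UNIV. H i l * (H k j *
            (\<Sum>p\<in>UNIV. \<Sum>q\<in>UNIV. H p q * (a z i k q * a' j p l))))"
      unfolding scalar_curv_hat_def chern_curv_eq[OF z] H a'_def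
      by (simp add: distrib_left right_diff_distrib sum.distrib sum_negf sum_subtractf sum_distrib_left mult.assoc)
    also have "(\<Sum>i\<in>UNIV. \<Sum>j\<in>UNIV. \<Sum>k\<in>UNIV. \<Sum>l\<in>UNIV. H i l * H k j * cnj (b z j i l k)) =
        (\<Sum>j\<in>UNIV. \<Sum>k\<in>UNIV. \<Sum>l\<in>UNIV. \<Sum>i\<in>UNIV. H i l * H k j * cnj (b z j i l k))"
      by (rule sum_rotate4[symmetric])
    also have "\<dots> = cnj ?T2"
      by (simp add: cnj_H sum_distrib_left mult_ac)
    also have "(\<Sum>i\<in>UNIV. \<Sum>j\<in>UNIV. \<Sum>k\<in>UNIV. \<Sum>l\<in>UNIV. H i l * (H k j *
            (\<Sum>p\<in>UNIV. \<Sum>q\<in>UNIV. H p q * (a z i k q * a' j p l)))) =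
        (\<Sum>i\<in>UNIV. \<Sum>l\<in>UNIV. \<Sum>k\<in>UNIV. \<Sum>j\<in>UNIV. H i l * (H k j *
            (\<Sum>p\<in>UNIV. \<Sum>q\<in>UNIV. H p q * (a z i k q * a' j p l))))"
      by (intro sum.cong refl sum_reverse3)
    also have "\<dots> = ?P2"
      unfolding sum_distrib_left[symmetric] sum_frame_coeff3_cross[symmetric] antihol_a' ..
    finally show ?thesis .
  qed
  ultimately have "scalar_curv g z - scalar_curv_hat g z = - cnj (?T1 - ?T2) + (?P1 - ?P2)"
    by simp
  also have "\<dots> = of_real (N - real m * (N - \<tau>) / real (Suc p))"
    unfolding T N by simp
  finally have diff: "scalar_curv g z - scalar_curv_hat g z =
      of_real (N - real m * (N - \<tau>) / real (Suc p))" .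
  have "0 \<le> N" "0 \<le> \<tau>"
    unfolding N_def \<tau>_def by (simp_all add: sum_nonneg)
  \<comment> \<open>The bound on \<open>m\<close> says that the weight m / (p + 1) of \<tau> is at
    most 1, so the weight left for \<open>N\<close> is nonnegative.\<close>
  then have "real m * N \<le> real (Suc p) * N" "0 \<le> real m * \<tau>"
    using m by (auto intro: mult_right_mono simp del: of_nat_Suc)
  then have "0 \<le> N - real m * (N - \<tau>) / real (Suc p)"
    by (simp add: field_simps)
  then have "0 \<le> scalar_curv g z - scalar_curv_hat g z"
    unfolding diff
    by (simp only: less_eq_complex_def zero_complex.simps Re_complex_of_real Im_complex_of_real)
  then show ?thesis
    by simp
qed

end

section \<open>From charts to the manifold\<close>

lemma hermitian_manifold_domain:
  assumes "hermitian_manifold X A h" "c \<in> A"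
  shows "hermitian_domain (snd c ` fst c) (h c)"
proof -
  interpret hermitian_manifold X A h by fact
  show ?thesis
  proof
    show "open (snd c ` fst c)" "smooth_on (snd c ` fst c) (\<lambda>z. h c z $ i $ j)" for i j
      using assms(2) by (rule chart_image, rule metric_smooth)
    show "h c z $ j $ i = cnj (h c z $ i $ j)" if "z \<in> snd c ` fst c" for z i j
      using that metric_hermitian[OF assms(2)] by blast
    show "0 < Re (\<Sum>i\<in>UNIV. \<Sum>j\<in>UNIV. h c z $ i $ j * v $ i * cnj (v $ j))"
      if "z \<in> snd c ` fst c" "v \<noteq> 0" for z v
      using that metric_pos[OF assms(2)] by blast
  qed
qed

lemma zero_wedge: "(\<lambda>I J. 0) \<and>\<^sub>f a = (\<lambda>I J. 0)"
  by (simp add: wedge_def)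

lemma k_gauduchonI:
  assumes "\<And>c p. c \<in> A \<Longrightarrow> p \<in> fst c \<Longrightarrow> ddbar_power (h c) k (snd c p) = (\<lambda>I J. 0)"
  shows "k_gauduchon A h k"
  using assms by (simp add: k_gauduchon_def zero_wedge)

theorem corollary4p6:
  fixes X :: "'a topology"
    and A :: "('a, 'n::{finite,linorder}) chart set"
    and h :: "('a, 'n) chart \<Rightarrow> 'n cvec \<Rightarrow> 'n cmat"
  assumes "hermitian_manifold X A h"
    and "CARD('n) \<ge> 3"
  shows "(\<forall>k. 1 \<le> k \<and> k \<le> CARD('n) - 1 \<and> k_gauduchon A h k \<longrightarrow> scalar_curv_ge_hat A h)
       \<and> (pluriclosed A h \<or> astheno_kaehler A h \<longrightarrow> scalar_curv_ge_hat A h)"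
proof -
  have main: "scalar_curv_ge_hat A h" if k: "1 \<le> k" "k \<le> CARD('n) - 1" and "k_gauduchon A h k" for k
    unfolding scalar_curv_ge_hat_def
  proof (intro ballI)
    fix c p assume cp: "c \<in> A" "p \<in> fst c"
    interpret hermitian_domain "snd c ` fst c" "h c"
      using assms(1) cp(1) by (rule hermitian_manifold_domain)
    obtain m where m: "k = Suc m"
      using k(1) by (cases k) auto
    \<comment> \<open>With k = m + 1 and n = p + 3 the bound k \<le> n - 1 becomes m \<le> p +
      1.\<close>
    have n: "CARD('n) = Suc (Suc (Suc (CARD('n) - 3)))" and "m \<le> Suc (CARD('n) - 3)"
      using assms(2) k(2) m by linarith+
    moreover have "ddbar_power (h c) (Suc m) (snd c p)
        \<and>\<^sub>f wedge_power (fundamental_form (h c) (snd c p)) (CARD('n) - Suc m - 1) = (\<lambda>I J. 0)"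
      using that(3) cp unfolding k_gauduchon_def m by blast
    ultimately show "scalar_curv_hat (h c) (snd c p) \<le> scalar_curv (h c) (snd c p)"
      using cp by (intro scalar_curv_ge_hat_at imageI)
  qed
  have "scalar_curv_ge_hat A h" if "pluriclosed A h"
  proof (rule main)
    show "k_gauduchon A h 1"
      using that by (intro k_gauduchonI) (simp add: pluriclosed_def ddbar_power_def wedge_one_form)
  qed (use assms(2) in linarith)+
  moreover have "scalar_curv_ge_hat A h" if "astheno_kaehler A h"
  proof (rule main)
    \<comment> \<open>The exponent n - 2 is an admissible k because n \<ge> 3 makes it at least
      1.\<close>
    show "k_gauduchon A h (CARD('n) - 2)"
      using that by (intro k_gauduchonI) (simp add: astheno_kaehler_def)
  qed (use assms(2) in linarith)+
  ultimately show ?thesis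
    using main by blast
qed

end
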